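(* Let $\Omega\subset\mathbb{H}^2$ be a bounded simply connected $C^{2,\alpha}$ domain. Suppose that a nonzero function $u\in C^2(\Omega)\cap C^1(\overline\Omega)$ satisfies $$\Delta_{\mathbb{H}^2}u-2u=0\ \text{ in }\Omega,\qquad u=a,\quad \partial_\nu u=b\ \text{ on }\partial\Omega,$$ where $a,b\in\mathbb{R}$ are constants with $a^2\neq b^2$. Then $\Omega$ is a geodesic disk and there is a constant $A\in\mathbb{R}$ such that $$u=A\cosh r,$$ where $r$ is the hyperbolic distance from the center of $\Omega$. In particular, $a^2-b^2=A^2>0$.
   Context: $\mathbb{H}^2$ is the hyperbolic plane of constant curvature $-1$, $\Delta_{\mathbb{H}^2}$ is its Laplace--Beltrami operator (the metric trace of the Hessian, so that $\Delta_{\mathbb{H}^2}\cosh r=2\cosh r$ for $r$ the distance from a fixed point), and $\nu$ is the exterior unit conormal (outward unit normal) along $\partial\Omega$. A domain is a connected open set; a $C^{2,\alpha}$ domain is one with boundary of class $C^{2,\alpha}$, $\alpha\in(0,1)$. "Nonzero" means not identically zero. *)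

theory Defs
  imports "HOL-Complex_Analysis.Complex_Analysis"
begin

text \<open>The hyperbolic plane of curvature \<open>-1\<close> is the Poincare disk: the set \<open>ball 0 1\<close> of
  complex numbers with the Riemannian metric \<open>4 |dz|^2 / (1 - |z|^2)^2\<close>.\<close>

definition hyp_metric :: "complex \<Rightarrow> complex \<Rightarrow> complex \<Rightarrow> real" where
  "hyp_metric z v w = 4 / (1 - (norm z)\<^sup>2)\<^sup>2 * (v \<bullet> w)"

text \<open>The coefficients \<open>g^{ij}\<close> of the inverse metric, indexed by basis vectors.\<close>

definition hyp_cometric :: "complex \<Rightarrow> complex \<Rightarrow> complex \<Rightarrow> real" where
  "hyp_cometric z i j = (1 - (norm z)\<^sup>2)\<^sup>2 / 4 * (i \<bullet> j)"

definition hyp_dist :: "complex \<Rightarrow> complex \<Rightarrow> real" where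
  "hyp_dist z w =
     arcosh (1 + 2 * (norm (z - w))\<^sup>2 / ((1 - (norm z)\<^sup>2) * (1 - (norm w)\<^sup>2)))"

definition hyp_disk :: "complex \<Rightarrow> real \<Rightarrow> complex set" where
  "hyp_disk c R = {z \<in> ball 0 1. hyp_dist c z < R}"

text \<open>The closure in \<open>ball 0 1\<close> of a hyperbolically bounded set is compact, so it is the closure in
  the complex plane; the same holds for the boundary. Hence \<^const>\<open>closure\<close> and
  \<^const>\<open>frontier\<close> have their intrinsic meaning for such sets.\<close>

definition hyp_bounded :: "complex set \<Rightarrow> bool" where
  "hyp_bounded S \<longleftrightarrow> (\<exists>c\<in>ball 0 1. \<exists>R. S \<subseteq> hyp_disk c R)"

definition dir_deriv :: "(complex \<Rightarrow> real) \<Rightarrow> complex \<Rightarrow> complex \<Rightarrow> real" where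
  "dir_deriv f e z = frechet_derivative f (at z) e"

text \<open>\<open>christoffel z i j k\<close> is the symbol \<open>\<Gamma>\<^sup>k\<^sub>i\<^sub>j\<close> of the Levi-Civita connection at \<open>z\<close>, for
  \<open>i\<close>, \<open>j\<close>, \<open>k\<close> in \<open>Basis = {1, \<i>}\<close>.\<close>

definition christoffel :: "complex \<Rightarrow> complex \<Rightarrow> complex \<Rightarrow> complex \<Rightarrow> real" where
  "christoffel z i j k = (\<Sum>l\<in>Basis. hyp_cometric z k l / 2 *
     (dir_deriv (\<lambda>w. hyp_metric w j l) i z + dir_deriv (\<lambda>w. hyp_metric w i l) j z
      - dir_deriv (\<lambda>w. hyp_metric w i j) l z))"

definition hyp_hessian :: "(complex \<Rightarrow> real) \<Rightarrow> complex \<Rightarrow> complex \<Rightarrow> complex \<Rightarrow> real" where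
  "hyp_hessian u z i j =
     dir_deriv (dir_deriv u j) i z - (\<Sum>k\<in>Basis. christoffel z i j k * dir_deriv u k z)"

definition hyp_laplacian :: "(complex \<Rightarrow> real) \<Rightarrow> complex \<Rightarrow> real" where
  "hyp_laplacian u z = (\<Sum>i\<in>Basis. \<Sum>j\<in>Basis. hyp_cometric z i j * hyp_hessian u z i j)"

lemma hyp_laplacian_conformal:
  assumes "z \<in> ball 0 1"
  shows "hyp_laplacian u z = (1 - (norm z)\<^sup>2)\<^sup>2 / 4 *
    (dir_deriv (dir_deriv u 1) 1 z + dir_deriv (dir_deriv u \<i>) \<i> z)"
proof -
  have 0: "dir_deriv (\<lambda>w. 0) e z = 0" for e by (simp add: dir_deriv_def)
  show ?thesis
    by (simp add: hyp_laplacian_def hyp_hessian_def christoffel_def hyp_metric_def hyp_cometric_def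
        Basis_complex_def 0 inner_complex_def algebra_simps)
qed

lemma dir_derivI:
  "(f has_derivative f') (at z) \<Longrightarrow> dir_deriv f e z = f' e"
  by (simp add: dir_deriv_def frechet_derivative_at[symmetric])

lemma dir_deriv_cong:
  assumes "open S" "z \<in> S" "\<And>w. w \<in> S \<Longrightarrow> f w = g w"
  shows "dir_deriv f e z = dir_deriv g e z"
proof -
  have "(f has_derivative D) (at z) = (g has_derivative D) (at z)" for D
    by (metis assms has_derivative_transform_within_open)
  then show ?thesis by (simp add: dir_deriv_def frechet_derivative_def)
qed

text \<open>The sign and the normalisation of the Laplacian and the distance agree with curvature \<open>-1\<close>.\<close>

lemma hyp_laplacian_cosh_dist:
  assumes c: "c \<in> ball 0 1" and z: "z \<in> ball 0 1"
  shows "hyp_laplacian (\<lambda>w. cosh (hyp_dist c w)) z = 2 * cosh (hyp_dist c z)"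
proof -
  let ?B = "ball 0 1 :: complex set"
  define k where "k = 1 - (norm c)\<^sup>2"
  have n1: "(norm w)\<^sup>2 < 1" if "w \<in> ?B" for w :: complex
    using that by (simp add: power_less_one_iff)
  have k: "k > 0" using n1[OF c] by (simp add: k_def)
  define g where "g w = 1 + 2 * ((w - c) \<bullet> (w - c)) / (k * (1 - w \<bullet> w))" for w
  have eq: "cosh (hyp_dist c w) = g w" if "w \<in> ?B" for w
  proof -
    have "g w \<ge> 1" using k n1[OF that] by (simp add: g_def power2_norm_eq_inner)
    then show ?thesis unfolding hyp_dist_def g_def k_def
      by (simp add: power2_norm_eq_inner[symmetric] norm_minus_commute cosh_arcosh_real)
  qed
  define g1 where "g1 e w = 4 * ((w - c) \<bullet> e) / (k * (1 - w \<bullet> w))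
     + 4 * ((w - c) \<bullet> (w - c)) * (w \<bullet> e) / (k * (1 - w \<bullet> w)^2)" for e w
  have pos: "1 - w \<bullet> w > 0" if "w \<in> ?B" for w using n1[OF that] by (simp add: power2_norm_eq_inner)
  have d1: "dir_deriv g e w = g1 e w" if "w \<in> ?B" for w e
    apply (rule trans[OF dir_derivI])
     apply (unfold g_def)
     apply (rule derivative_eq_intros refl | use pos[OF that] k in force)+
    using pos[OF that] k
    apply (simp add: g1_def inner_commute divide_simps power2_eq_square)
    done
  have d2: "dir_deriv (g1 e) e w = 4 * (e \<bullet> e) / (k * (1 - w \<bullet> w))
     + 16 * ((w - c) \<bullet> e) * (w \<bullet> e) / (k * (1 - w \<bullet> w)^2)
     + 4 * ((w - c) \<bullet> (w - c)) * (e \<bullet> e) / (k * (1 - w \<bullet> w)^2)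
     + 16 * ((w - c) \<bullet> (w - c)) * (w \<bullet> e)^2 / (k * (1 - w \<bullet> w)^3)" if "w \<in> ?B" for w e
    apply (rule trans[OF dir_derivI])
     apply (unfold g1_def)
     apply (rule derivative_eq_intros refl | use pos[OF that] k in force)+
    using pos[OF that] k
    apply (simp add: inner_commute divide_simps power2_eq_square power3_eq_cube)
    apply (simp add: algebra_simps)
    done
  have dd: "dir_deriv (dir_deriv (\<lambda>w. cosh (hyp_dist c w)) e) e z = dir_deriv (g1 e) e z" for e
    apply (rule dir_deriv_cong[of ?B])
    using z apply simp_all
    by (metis (no_types, lifting) d1 dir_deriv_cong eq mem_ball_0 open_ball)
  obtain x y p q where zc: "z = Complex x y" "c = Complex p q" by (metis complex.exhaust)
  show ?thesis
    unfolding hyp_laplacian_conformal[OF z] dd d2[OF z] eq[OF z] g_def power2_norm_eq_inner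
    using pos[OF z] k
    unfolding k_def zc inner_complex_def power2_norm_eq_inner
    apply (simp add: divide_simps)
    apply (simp add: power2_eq_square power3_eq_cube)
    by algebra
qed

definition C2_on :: "complex set \<Rightarrow> (complex \<Rightarrow> real) \<Rightarrow> bool" where
  "C2_on S u \<longleftrightarrow> (\<exists>(u' :: complex \<Rightarrow> complex \<Rightarrow>\<^sub>L real)
       (u'' :: complex \<Rightarrow> complex \<Rightarrow>\<^sub>L complex \<Rightarrow>\<^sub>L real).
     (\<forall>z\<in>S. (u has_derivative blinfun_apply (u' z)) (at z)) \<and>
     (\<forall>z\<in>S. (u' has_derivative blinfun_apply (u'' z)) (at z)) \<and>
     continuous_on S u'')"

text \<open>The class \<open>C\<^sup>1\<close> of the closure: the function and its differential, defined on the open set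
  \<open>S\<close>, extend continuously to the closure.\<close>

definition C1_closure :: "complex set \<Rightarrow> (complex \<Rightarrow> real) \<Rightarrow> bool" where
  "C1_closure S u \<longleftrightarrow> continuous_on (closure S) u \<and>
     (\<exists>u' :: complex \<Rightarrow> complex \<Rightarrow>\<^sub>L real. continuous_on (closure S) u' \<and>
        (\<forall>z\<in>S. (u has_derivative blinfun_apply (u' z)) (at z)))"

definition C2_holder_on :: "real \<Rightarrow> real set \<Rightarrow> (real \<Rightarrow> real) \<Rightarrow> bool" where
  "C2_holder_on \<alpha> I \<gamma> \<longleftrightarrow> (\<exists>\<gamma>' \<gamma>''.
     (\<forall>t\<in>I. (\<gamma> has_real_derivative \<gamma>' t) (at t)) \<and>
     (\<forall>t\<in>I. (\<gamma>' has_real_derivative \<gamma>'' t) (at t)) \<and>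
     (\<exists>C. \<forall>s\<in>I. \<forall>t\<in>I. \<bar>\<gamma>'' s - \<gamma>'' t\<bar> \<le> C * \<bar>s - t\<bar> powr \<alpha>))"

text \<open>After a rotation by the unit number \<open>e\<close> about the boundary point \<open>p\<close>, the set is near \<open>p\<close>
  the part of the plane above the graph of a function of class \<open>C^{2,\<alpha>}\<close>. The notion does
  not change under diffeomorphisms, so it may be stated in the coordinates of the disk.\<close>

definition C2_holder_boundary :: "real \<Rightarrow> complex set \<Rightarrow> bool" where
  "C2_holder_boundary \<alpha> S \<longleftrightarrow> (\<forall>p\<in>frontier S. \<exists>e r \<gamma>. norm e = 1 \<and> r > 0 \<and>
     C2_holder_on \<alpha> {-r<..<r} \<gamma> \<and>
     S \<inter> ball p r = {z \<in> ball p r. Im ((z - p) / e) > \<gamma> (Re ((z - p) / e))})"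

definition boundary_tangent :: "complex set \<Rightarrow> complex \<Rightarrow> complex \<Rightarrow> bool" where
  "boundary_tangent S z v \<longleftrightarrow> (\<exists>c :: real \<Rightarrow> complex. c 0 = z \<and> (\<forall>t. c t \<in> frontier S) \<and>
     (c has_vector_derivative v) (at 0))"

definition exterior_unit_normal :: "complex set \<Rightarrow> complex \<Rightarrow> complex \<Rightarrow> bool" where
  "exterior_unit_normal S z n \<longleftrightarrow>
     hyp_metric z n n = 1 \<and> (\<forall>v. boundary_tangent S z v \<longrightarrow> hyp_metric z n v = 0) \<and>
     (\<exists>\<epsilon>>0. \<forall>t\<in>{0<..<\<epsilon>}. z - t *\<^sub>R n \<in> S \<and> z + t *\<^sub>R n \<notin> closure S)"

text \<open>The derivative of \<open>u\<close> at the boundary point \<open>z\<close> in the exterior direction \<open>n\<close> is one-sided,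
  as \<open>u\<close> is only given on the closure of the domain. The straight segment may replace the
  geodesic because both have velocity \<open>n\<close> at \<open>z\<close>.\<close>

definition has_exterior_derivative ::
    "(complex \<Rightarrow> real) \<Rightarrow> complex \<Rightarrow> complex \<Rightarrow> real \<Rightarrow> bool" where
  "has_exterior_derivative u n z b \<longleftrightarrow> ((\<lambda>t. (u z - u (z - t *\<^sub>R n)) / t) \<longlongrightarrow> b) (at_right 0)"

end

theory Submission
  imports Defs
begin

text \<open>
The proof is Weinberger's argument for Serrin's problem, carried over to the hyperbolic plane.
Multiplying \<open>u\<close> by \<open>-1\<close> if necessary, let \<open>a > 0\<close>; for \<open>a = 0\<close> the maximum principle gives
\<open>u = 0\<close>. The maximum principle also gives \<open>0 \<le> u < a\<close> in the domain.

The function \<open>P = |\<nabla>u|\<^sup>2 - u\<^sup>2\<close>, with the hyperbolic gradient, is constant when \<open>u\<close> is a multiple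
of \<open>cosh r\<close>. In general the trace-free Hessian \<open>T\<close> of \<open>u\<close> is a Codazzi tensor, so in the complex
coordinate it is given by a holomorphic function \<open>hopf\<close> (lemma \<open>hopf_holomorphic\<close>), and the
Laplacian of \<open>P\<close> is a positive multiple of \<open>|T|\<^sup>2\<close> (lemma \<open>laplacian_P_fun\<close>). Hence \<open>P\<close> is
subharmonic, and it is at most its boundary value \<open>b\<^sup>2 - a\<^sup>2\<close> (lemma \<open>P_fun_le\<close>).

For \<open>V = cosh r\<close>, the distance being taken from the origin of the disk, the field \<open>\<nabla>V\<close> is conformal
with divergence \<open>2V\<close>. Combining the Pohozaev identity for this field with Green's identities gives a
field \<open>Y\<close> that is quadratic in \<open>(u, \<nabla>u)\<close>, satisfies \<open>div Y = V (P - b\<^sup>2 + a\<^sup>2)\<close>, and is orthogonal to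
\<open>\<nabla>u\<close> wherever \<open>u = a\<close> and \<open>|\<nabla>u| = |b|\<close>, that is, tangent to the boundary. So the integral of
\<open>V (P - b\<^sup>2 + a\<^sup>2)\<close> is zero, and as the integrand is nonpositive, \<open>P\<close> is constant (lemma
\<open>P_fun_eq\<close>). To avoid integrals over the boundary, \<open>Y\<close> is multiplied by a cutoff function of
\<open>(a - u)/\<epsilon>\<close>. The derivative of the cutoff meets only the component of \<open>Y\<close> along \<open>\<nabla>u\<close>, which is
small compared with \<open>|\<nabla>u|\<^sup>2\<close> near the boundary. Hence adding \<open>\<delta> \<nabla>u\<close> to \<open>Y\<close> gives this term a sign,
and it changes the divergence by \<open>\<delta> \<Delta>u\<close>, which is arbitrarily small.

When \<open>P\<close> is constant, \<open>T\<close> vanishes, and then \<open>u\<close> is the restriction of a linear function to the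
hyperboloid. At an interior minimum \<open>m\<close> its gradient is zero, so \<open>u = u(m) cosh r\<close> with \<open>r\<close> the
distance from \<open>m\<close> (lemma \<open>radial_of_hopf_zero\<close>), and \<open>P(m) = - u(m)\<^sup>2\<close> gives the value of
\<open>a\<^sup>2 - b\<^sup>2\<close>. The domain lies in the disk \<open>u(m) cosh r < a\<close>, which is connected and does not meet
the frontier of the domain, so the two are equal.

Throughout, the calculation is done with the Wirtinger derivatives \<open>\<partial>\<^sub>z\<close> and \<open>\<partial>\<^sub>\<zeta>\<close>, where \<open>\<zeta>\<close>
denotes the conjugate of \<open>z\<close>; with \<open>t = 1 - |z|\<^sup>2\<close> the equation reads \<open>\<partial>\<^sub>\<zeta>\<partial>\<^sub>z u = 2u/t\<^sup>2\<close>.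
\<close>

section \<open>Wirtinger derivatives\<close>

text \<open>The numbers \<open>A\<close> and \<open>B\<close> are the Wirtinger derivatives of \<open>f\<close> with respect to \<open>z\<close> and to the
conjugate of \<open>z\<close>. Both act as derivations, and \<open>B = cnj A\<close> for real-valued \<open>f\<close>, so
long real computations become short polynomial ones.\<close>

definition has_wirtinger ::
    "(complex \<Rightarrow> complex) \<Rightarrow> complex \<Rightarrow> complex \<Rightarrow> complex \<Rightarrow> bool" where
  "has_wirtinger f A B z \<longleftrightarrow> (f has_derivative (\<lambda>h. A * h + B * cnj h)) (at z)"

lemma has_wirtinger_eqI:
  "has_wirtinger f A B z \<Longrightarrow> A = A' \<Longrightarrow> B = B' \<Longrightarrow> has_wirtinger f A' B' z"
  by simp

lemma has_wirtinger_const: "has_wirtinger (\<lambda>z. k) 0 0 z"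
  by (simp add: has_wirtinger_def)

lemma has_wirtinger_ident: "has_wirtinger (\<lambda>z. z) 1 0 z"
  by (simp add: has_wirtinger_def)

lemma has_wirtinger_cnj:
  assumes "has_wirtinger f A B z"
  shows "has_wirtinger (\<lambda>z. cnj (f z)) (cnj B) (cnj A) z"
  using has_derivative_cnj[OF assms[unfolded has_wirtinger_def]]
  by (simp add: has_wirtinger_def add.commute)

lemma has_wirtinger_add:
  assumes "has_wirtinger f A B z" "has_wirtinger g C D z"
  shows "has_wirtinger (\<lambda>z. f z + g z) (A + C) (B + D) z"
  using has_derivative_add[OF assms[unfolded has_wirtinger_def]]
  by (simp add: has_wirtinger_def algebra_simps)

lemma has_wirtinger_minus:
  assumes "has_wirtinger f A B z"
  shows "has_wirtinger (\<lambda>z. - f z) (- A) (- B) z"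
  using has_derivative_minus[OF assms[unfolded has_wirtinger_def]]
  by (simp add: has_wirtinger_def algebra_simps)

lemma has_wirtinger_diff:
  assumes "has_wirtinger f A B z" "has_wirtinger g C D z"
  shows "has_wirtinger (\<lambda>z. f z - g z) (A - C) (B - D) z"
  using has_derivative_diff[OF assms[unfolded has_wirtinger_def]]
  by (simp add: has_wirtinger_def algebra_simps)

lemma has_wirtinger_mult:
  assumes "has_wirtinger f A B z" "has_wirtinger g C D z"
  shows "has_wirtinger (\<lambda>z. f z * g z) (f z * C + A * g z) (f z * D + B * g z) z"
  using has_derivative_mult[OF assms[unfolded has_wirtinger_def]]
  by (simp add: has_wirtinger_def algebra_simps)

lemma has_wirtinger_inverse:
  assumes "has_wirtinger f A B z" "f z \<noteq> 0"
  shows "has_wirtinger (\<lambda>z. inverse (f z)) (- A / (f z)\<^sup>2) (- B / (f z)\<^sup>2) z"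
proof -
  have "((\<lambda>z. inverse (f z)) has_derivative
      (\<lambda>h. - (inverse (f z) * (A * h + B * cnj h) * inverse (f z)))) (at z)"
    using assms unfolding has_wirtinger_def by (intro derivative_intros)
  moreover have "(\<lambda>h. - (inverse (f z) * (A * h + B * cnj h) * inverse (f z)))
      = (\<lambda>h. - A / (f z)\<^sup>2 * h + - B / (f z)\<^sup>2 * cnj h)"
    using assms(2) by (auto simp: fun_eq_iff field_simps power2_eq_square)
  ultimately show ?thesis unfolding has_wirtinger_def by simp
qed

lemma has_wirtinger_divide:
  assumes "has_wirtinger f A B z" "has_wirtinger g C D z" "g z \<noteq> 0"
  shows "has_wirtinger (\<lambda>z. f z / g z) ((A * g z - f z * C) / (g z)\<^sup>2)
      ((B * g z - f z * D) / (g z)\<^sup>2) z"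
  unfolding divide_inverse[of "f _"]
  by (rule has_wirtinger_eqI[OF has_wirtinger_mult[OF assms(1) has_wirtinger_inverse[OF assms(2,3)]]])
     (use assms(3) in \<open>simp_all add: field_simps power2_eq_square\<close>)

lemma has_wirtinger_power2:
  assumes "has_wirtinger f A B z"
  shows "has_wirtinger (\<lambda>z. (f z)\<^sup>2) (2 * f z * A) (2 * f z * B) z"
  unfolding power2_eq_square
  by (rule has_wirtinger_eqI[OF has_wirtinger_mult[OF assms assms]]) simp_all

lemmas has_wirtinger_intros = has_wirtinger_const has_wirtinger_ident has_wirtinger_cnj
  has_wirtinger_add has_wirtinger_minus has_wirtinger_diff has_wirtinger_divide
  has_wirtinger_power2 has_wirtinger_mult

lemma has_wirtinger_of_real_comp:
  assumes f: "has_wirtinger (\<lambda>z. complex_of_real (f z)) A B z"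
    and \<phi>: "(\<phi> has_real_derivative d) (at (f z))"
  shows "has_wirtinger (\<lambda>z. complex_of_real (\<phi> (f z))) (d * A) (d * B) z"
proof -
  have "((\<lambda>z. Re (complex_of_real (f z))) has_derivative (\<lambda>h. Re (A * h + B * cnj h))) (at z)"
    using f unfolding has_wirtinger_def by (rule has_derivative_Re)
  then have fr: "(f has_derivative (\<lambda>h. Re (A * h + B * cnj h))) (at z)" by simp
  have im: "Im (A * h + B * cnj h) = 0" for h
  proof -
    have "((\<lambda>z. Im (complex_of_real (f z))) has_derivative (\<lambda>h. Im (A * h + B * cnj h))) (at z)"
      using f unfolding has_wirtinger_def by (rule has_derivative_Im)
    then have "((\<lambda>z. 0::real) has_derivative (\<lambda>h. Im (A * h + B * cnj h))) (at z)" by simp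
    then show ?thesis using has_derivative_unique[OF _ has_derivative_const] by metis
  qed
  have "((\<lambda>z. \<phi> (f z)) has_derivative (\<lambda>h. Re (A * h + B * cnj h) * d)) (at z)"
    using has_derivative_compose[OF fr \<phi>[unfolded has_field_derivative_def]]
    by (simp add: mult.commute)
  then have "((\<lambda>z. complex_of_real (\<phi> (f z))) has_derivative
      (\<lambda>h. complex_of_real (Re (A * h + B * cnj h) * d))) (at z)"
    by (rule has_derivative_of_real)
  moreover have "complex_of_real (Re (A * h + B * cnj h) * d) = d * A * h + d * B * cnj h" for h
  proof -
    have "A * h + B * cnj h = complex_of_real (Re (A * h + B * cnj h))"
      using im[of h] by (simp add: complex_eq_iff)
    then show ?thesis by (metis distrib_left mult.assoc mult.commute of_real_mult)
  qed
  ultimately show ?thesis by (simp add: has_wirtinger_def)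
qed

lemma has_wirtinger_unique:
  assumes "has_wirtinger f A B z" "has_wirtinger f C D z"
  shows "A = C" "B = D"
proof -
  have "(\<lambda>h. A * h + B * cnj h) = (\<lambda>h. C * h + D * cnj h)"
    using has_derivative_unique assms unfolding has_wirtinger_def by blast
  note e = fun_cong[OF this]
  have 1: "A + B = C + D" using e[of 1] by simp
  have "\<i> * (A - B) = \<i> * (C - D)" using e[of \<i>] by (simp add: algebra_simps)
  then have 2: "A - B = C - D" by simp
  have "2 * A = 2 * C" using arg_cong2[OF 1 2, of "(+)"] by simp
  then show "A = C" by simp
  then show "B = D" using 1 by simp
qed

lemma has_wirtinger_transform_open:
  assumes "has_wirtinger f A B z" "open S" "z \<in> S" "\<And>w. w \<in> S \<Longrightarrow> f w = g w"
  shows "has_wirtinger g A B z"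
  using assms has_derivative_transform_within_open unfolding has_wirtinger_def by blast

lemma has_wirtinger_imp_continuous_on:
  assumes "\<And>z. z \<in> S \<Longrightarrow> has_wirtinger f (A z) (B z) z"
  shows "continuous_on S f"
  using assms has_derivative_continuous continuous_at_imp_continuous_on
  unfolding has_wirtinger_def by blast

lemma has_wirtinger_line:
  assumes "has_wirtinger f A B (z + of_real t * e)"
  shows "((\<lambda>s. f (z + of_real s * e)) has_vector_derivative (A * e + B * cnj e)) (at t)"
proof -
  have "((\<lambda>s. z + of_real s * e) has_derivative (\<lambda>s. of_real s * e)) (at t)"
    by (auto intro!: derivative_eq_intros)
  from has_derivative_compose[OF this assms[unfolded has_wirtinger_def]]
  show ?thesis by (simp add: has_vector_derivative_def scaleR_conv_of_real algebra_simps)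
qed

lemma has_wirtinger_holomorphic:
  assumes "(f has_field_derivative d) (at z)"
  shows "has_wirtinger f d 0 z"
  using assms by (simp add: has_wirtinger_def has_field_derivative_def)

lemma has_wirtinger_zero_imp_constant:
  assumes "open S" "connected S" "\<And>z. z \<in> S \<Longrightarrow> has_wirtinger f 0 0 z" "x \<in> S" "y \<in> S"
  shows "f x = f y"
proof -
  have "(f has_field_derivative 0) (at z)" if "z \<in> S" for z
    using assms(3)[OF that]
    by (simp add: has_wirtinger_def has_field_derivative_def mult_zero_left[abs_def])
  then have "f constant_on S"
    using has_field_derivative_0_imp_constant_on[OF _ assms(2,1)] by blast
  then show ?thesis using assms(4,5) by (auto simp: constant_on_def)
qed

text \<open>The Poincare lemma for the form \<open>k dz + h d\<zeta>\<close>; the shared function \<open>k2\<close> in the two derivative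
hypotheses says that the form is closed. The primitive is its integral along the rays from the
centre, differentiated under the integral sign.\<close>

lemma wirtinger_poincare_ball:
  fixes k h k1 k2 h2 :: "complex \<Rightarrow> complex"
  assumes r: "r > 0"
    and k: "\<And>z. z \<in> ball z0 r \<Longrightarrow> has_wirtinger k (k1 z) (k2 z) z"
    and h: "\<And>z. z \<in> ball z0 r \<Longrightarrow> has_wirtinger h (k2 z) (h2 z) z"
    and c: "continuous_on (ball z0 r) k1" "continuous_on (ball z0 r) k2"
      "continuous_on (ball z0 r) h2"
  shows "\<exists>G. \<forall>z\<in>ball z0 r. has_wirtinger G (k z) (h z) z"
proof -
  let ?U = "ball z0 r"
  define p where "p z t = z0 + of_real t * (z - z0)" for z and t :: real
  define F where "F z t = k (p z t) * (z - z0) + h (p z t) * cnj (z - z0)" for z t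
  define D1 where "D1 z t = k (p z t) + of_real t * (k1 (p z t) * (z - z0) + k2 (p z t) * cnj (z - z0))" for z t
  define D2 where "D2 z t = h (p z t) + of_real t * (k2 (p z t) * (z - z0) + h2 (p z t) * cnj (z - z0))" for z t
  define D where "D z t = Blinfun (\<lambda>v. D1 z t * v + D2 z t * cnj v)" for z t
  have pU: "p z t \<in> ?U" if "z \<in> ?U" "t \<in> {0..1}" for z t
  proof -
    have "norm (of_real t * (z - z0)) \<le> norm (z - z0)"
      using that by (simp add: norm_mult mult_left_le_one_le)
    then show ?thesis using that by (simp add: p_def dist_norm norm_minus_commute)
  qed
  have bl: "bounded_linear (\<lambda>v. a * v + b * cnj v)" for a b :: complex
    by (intro bounded_linear_add bounded_linear_mult_right
        bounded_linear_compose[OF bounded_linear_mult_right bounded_linear_cnj])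
  have Dapp: "blinfun_apply (D z t) v = D1 z t * v + D2 z t * cnj v" for z t v
    unfolding D_def by (subst bounded_linear_Blinfun_apply[OF bl]) simp
  have wp: "has_wirtinger (\<lambda>z. p z t) (of_real t) 0 z" for z t
    unfolding p_def by (rule has_wirtinger_eqI, (rule has_wirtinger_intros)+) simp_all
  have comp: "has_wirtinger (\<lambda>z. f (p z t)) (of_real t * a) (of_real t * b) z"
    if "has_wirtinger f a b (p z t)" for f a b z t
    using has_derivative_compose[OF wp[unfolded has_wirtinger_def] that[unfolded has_wirtinger_def]]
    by (simp add: has_wirtinger_def algebra_simps)
  have dF: "((\<lambda>z. F z t) has_derivative blinfun_apply (D z t)) (at z within ?U)"
    if "z \<in> ?U" "t \<in> cbox 0 1" for z t
  proof -
    have t: "t \<in> {0..1}" using that by simp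
    have "has_wirtinger (\<lambda>z. F z t) (D1 z t) (D2 z t) z"
      unfolding F_def D1_def D2_def
      by (rule has_wirtinger_eqI, (rule has_wirtinger_intros comp[OF k] comp[OF h] pU that t)+)
         (simp_all add: algebra_simps)
    moreover have "blinfun_apply (D z t) = (\<lambda>v. D1 z t * v + D2 z t * cnj v)"
      by (rule ext) (rule Dapp)
    ultimately show ?thesis unfolding has_wirtinger_def
      by (simp add: has_derivative_at_withinI)
  qed
  have ck: "continuous_on ?U k" and ch: "continuous_on ?U h"
    using k h has_wirtinger_imp_continuous_on by blast+
  have pc: "continuous_on X (\<lambda>x. p (f x) (g x))" if "continuous_on X f" "continuous_on X g"
    for X :: "'x::topological_space set" and f g
    unfolding p_def by (intro continuous_intros that)
  have cF: "continuous_on (cbox 0 1) (F z)" if "z \<in> ?U" for z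
    unfolding F_def
    by (intro continuous_intros continuous_on_compose2[OF ck] continuous_on_compose2[OF ch] pc)
       (use pU that in auto)
  have cD12: "continuous_on (?U \<times> cbox 0 1) (\<lambda>(z, t). D1 z t)"
       "continuous_on (?U \<times> cbox 0 1) (\<lambda>(z, t). D2 z t)"
    unfolding D1_def D2_def split_beta
    by (intro continuous_intros continuous_on_compose2[OF ck] continuous_on_compose2[OF ch] pc
        continuous_on_compose2[OF c(1)] continuous_on_compose2[OF c(2)]
        continuous_on_compose2[OF c(3)]; use pU in force)+
  have cD: "continuous_on (?U \<times> cbox 0 1) (\<lambda>(z, t). D z t)"
  proof (rule continuous_on_blinfun_componentwise)
    fix i :: complex assume "i \<in> Basis"
    have "continuous_on (?U \<times> cbox 0 1) (\<lambda>x. (case x of (z, t) \<Rightarrow> D1 z t) * i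
        + (case x of (z, t) \<Rightarrow> D2 z t) * cnj i)"
      by (intro continuous_intros cD12)
    then show "continuous_on (?U \<times> cbox 0 1) (\<lambda>x. blinfun_apply (case x of (z, t) \<Rightarrow> D z t) i)"
      by (simp add: split_beta Dapp)
  qed
  define G where "G z = integral (cbox 0 1) (F z)" for z
  have "has_wirtinger G (k z) (h z) z" if z: "z \<in> ?U" for z
  proof -
    have GD: "(G has_derivative blinfun_apply (integral (cbox 0 1) (D z))) (at z within ?U)"
      unfolding G_def
      by (rule leibniz_rule[OF dF integrable_continuous[OF cF] cD z convex_ball])
    have cDz: "continuous_on (cbox 0 1) (D z)"
      using continuous_on_compose2[OF cD, of "cbox 0 1" "\<lambda>t. (z, t)"] z
      by (force intro: continuous_intros)
    have eq: "blinfun_apply (integral (cbox 0 1) (D z)) v = k z * v + h z * cnj v" for v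
    proof -
      have "((\<lambda>t. blinfun_apply (D z t) v) has_integral
          blinfun_apply (integral (cbox 0 1) (D z)) v) (cbox 0 1)"
        using has_integral_linear[OF integrable_integral[OF integrable_continuous[OF cDz]]
            blinfun.bounded_linear_left[of v]]
        by (simp add: o_def)
      moreover have "((\<lambda>t. blinfun_apply (D z t) v) has_integral
          (of_real 1 * (k (p z 1) * v + h (p z 1) * cnj v)
           - of_real 0 * (k (p z 0) * v + h (p z 0) * cnj v))) {0..1}"
      proof (rule fundamental_theorem_of_calculus)
        fix t :: real assume t: "t \<in> {0..1}"
        have dk: "((\<lambda>t. k (p z t)) has_vector_derivative
             (k1 (p z t) * (z - z0) + k2 (p z t) * cnj (z - z0))) (at t)"
          unfolding p_def by (rule has_wirtinger_line) (use k pU[OF z t] in \<open>simp add: p_def\<close>)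
        have dh: "((\<lambda>t. h (p z t)) has_vector_derivative
             (k2 (p z t) * (z - z0) + h2 (p z t) * cnj (z - z0))) (at t)"
          unfolding p_def by (rule has_wirtinger_line) (use h pU[OF z t] in \<open>simp add: p_def\<close>)
        have dt: "(complex_of_real has_vector_derivative 1) (at t)"
          using has_vector_derivative_of_real[OF DERIV_ident, of "at t"] by simp
        have "((\<lambda>t. of_real t * (k (p z t) * v + h (p z t) * cnj v))
           has_vector_derivative (D1 z t * v + D2 z t * cnj v)) (at t)"
          unfolding D1_def D2_def
          by (rule has_vector_derivative_eq_rhs[OF has_vector_derivative_mult[OF dt
                has_vector_derivative_add[OF has_vector_derivative_mult_left[OF dk]
                  has_vector_derivative_mult_left[OF dh]]]])
             (simp add: algebra_simps)
        then show "((\<lambda>t. of_real t * (k (p z t) * v + h (p z t) * cnj v))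
           has_vector_derivative (blinfun_apply (D z t) v)) (at t within {0..1})"
          by (simp add: Dapp has_vector_derivative_at_within)
      qed simp
      ultimately show ?thesis
        by (simp add: p_def has_integral_unique)
    qed
    have "blinfun_apply (integral (cbox 0 1) (D z)) = (\<lambda>v. k z * v + h z * cnj v)"
      by (rule ext) (rule eq)
    then show ?thesis
      using GD unfolding has_wirtinger_def by (simp add: at_within_open[OF z open_ball])
  qed
  then show ?thesis by blast
qed

section \<open>Second derivatives and the maximum principle\<close>

lemma has_real_derivative_line:
  fixes f :: "'a::real_normed_vector \<Rightarrow> real"
  assumes "(f has_derivative D) (at (p + s *\<^sub>R v))"
  shows "((\<lambda>s. f (p + s *\<^sub>R v)) has_real_derivative D v) (at s)"
proof -
  have l: "linear D" using assms has_derivative_linear by blast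
  have "((\<lambda>s. p + s *\<^sub>R v) has_derivative (\<lambda>s. s *\<^sub>R v)) (at s)"
    by (auto intro!: derivative_eq_intros)
  from has_derivative_compose[OF this assms]
  show ?thesis by (simp add: has_field_derivative_def linear_cmul[OF l] mult_commute_abs)
qed

text \<open>The second difference is symmetric in \<open>v\<close> and \<open>w\<close>, whereas the right-hand side is not; this is
what makes second derivatives symmetric.\<close>

lemma second_difference_mean_value:
  fixes f :: "'a::real_normed_vector \<Rightarrow> real" and f' :: "'a \<Rightarrow> 'a \<Rightarrow>\<^sub>L real"
    and f'' :: "'a \<Rightarrow> 'a \<Rightarrow>\<^sub>L 'a \<Rightarrow>\<^sub>L real"
  assumes f': "\<And>x. x \<in> ball z r \<Longrightarrow> (f has_derivative blinfun_apply (f' x)) (at x)"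
    and f'': "\<And>x. x \<in> ball z r \<Longrightarrow> (f' has_derivative blinfun_apply (f'' x)) (at x)"
    and h: "h > 0" "h * (norm v + norm w) < r"
  shows "\<exists>p\<in>ball z r. f (z + h *\<^sub>R v + h *\<^sub>R w) - f (z + h *\<^sub>R v) - f (z + h *\<^sub>R w) + f z
           = h\<^sup>2 * f'' p w v"
proof -
  have inb: "z + s *\<^sub>R v + t *\<^sub>R w \<in> ball z r" if "0 \<le> s" "s \<le> h" "0 \<le> t" "t \<le> h" for s t
  proof -
    have "norm (s *\<^sub>R v + t *\<^sub>R w) \<le> s * norm v + t * norm w"
      using that by (intro norm_triangle_le) simp
    also have "\<dots> \<le> h * (norm v + norm w)"
      using that by (simp add: distrib_left add_mono mult_right_mono)
    finally have "norm (s *\<^sub>R v + t *\<^sub>R w) < r" using h by simp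
    then show ?thesis using norm_minus_cancel[of "s *\<^sub>R v + t *\<^sub>R w"] by (simp add: dist_norm)
  qed
  define \<phi> where "\<phi> s = f (z + h *\<^sub>R w + s *\<^sub>R v) - f (z + s *\<^sub>R v)" for s
  have d\<phi>: "DERIV \<phi> s :> f' (z + h *\<^sub>R w + s *\<^sub>R v) v - f' (z + s *\<^sub>R v) v"
    if "0 \<le> s" "s \<le> h" for s
    unfolding \<phi>_def
    by (intro DERIV_diff has_real_derivative_line f')
       (use inb[OF that, of h] inb[OF that, of 0] h in \<open>simp_all add: algebra_simps\<close>)
  obtain \<xi> where \<xi>: "0 < \<xi>" "\<xi> < h"
      "\<phi> h - \<phi> 0 = (h - 0) * (f' (z + h *\<^sub>R w + \<xi> *\<^sub>R v) v - f' (z + \<xi> *\<^sub>R v) v)"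
    using MVT2[OF h(1) d\<phi>] by blast
  define \<psi> where "\<psi> t = f' (z + \<xi> *\<^sub>R v + t *\<^sub>R w) v" for t
  have d\<psi>: "DERIV \<psi> t :> f'' (z + \<xi> *\<^sub>R v + t *\<^sub>R w) w v" if "0 \<le> t" "t \<le> h" for t
    unfolding \<psi>_def
  proof (rule has_real_derivative_line[where f = "\<lambda>x. f' x v"
        and D = "\<lambda>y. f'' (z + \<xi> *\<^sub>R v + t *\<^sub>R w) y v"])
    have "z + \<xi> *\<^sub>R v + t *\<^sub>R w \<in> ball z r" using inb \<xi> that by simp
    from bounded_linear.has_derivative[OF blinfun.bounded_linear_left f''[OF this]]
    show "((\<lambda>x. f' x v) has_derivative (\<lambda>y. f'' (z + \<xi> *\<^sub>R v + t *\<^sub>R w) y v))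
        (at (z + \<xi> *\<^sub>R v + t *\<^sub>R w))" .
  qed
  obtain \<eta> where \<eta>: "0 < \<eta>" "\<eta> < h" "\<psi> h - \<psi> 0 = (h - 0) * f'' (z + \<xi> *\<^sub>R v + \<eta> *\<^sub>R w) w v"
    using MVT2[OF h(1) d\<psi>] by blast
  have "\<phi> h - \<phi> 0 = h * (h * f'' (z + \<xi> *\<^sub>R v + \<eta> *\<^sub>R w) w v)"
    using \<xi>(3) \<eta>(3) by (simp add: \<psi>_def algebra_simps)
  then show ?thesis
    by (intro bexI[of _ "z + \<xi> *\<^sub>R v + \<eta> *\<^sub>R w"] inb)
       (use \<xi> \<eta> in \<open>simp_all add: \<phi>_def power2_eq_square algebra_simps\<close>)
qed

lemma second_derivative_symmetric:
  fixes f :: "'a::real_normed_vector \<Rightarrow> real" and f' :: "'a \<Rightarrow> 'a \<Rightarrow>\<^sub>L real"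
    and f'' :: "'a \<Rightarrow> 'a \<Rightarrow>\<^sub>L 'a \<Rightarrow>\<^sub>L real"
  assumes S: "open S" "z \<in> S"
    and f': "\<And>x. x \<in> S \<Longrightarrow> (f has_derivative blinfun_apply (f' x)) (at x)"
    and f'': "\<And>x. x \<in> S \<Longrightarrow> (f' has_derivative blinfun_apply (f'' x)) (at x)"
    and cont: "continuous_on S f''"
  shows "f'' z v w = f'' z w v"
proof -
  have "\<bar>f'' z v w - f'' z w v\<bar> \<le> 0 + e" if e: "e > 0" for e
  proof -
    have near: "\<exists>d>0. ball z d \<subseteq> S \<and> (\<forall>p\<in>ball z d. \<bar>f'' p a b - f'' z a b\<bar> < e / 2)" for a b
    proof -
      have "continuous_on S (\<lambda>p. f'' p a b)" by (intro continuous_intros cont)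
      then have "open (S \<inter> (\<lambda>p. f'' p a b) -` ball (f'' z a b) (e / 2))"
        using S(1) by (simp add: continuous_open_preimage)
      moreover have "z \<in> S \<inter> (\<lambda>p. f'' p a b) -` ball (f'' z a b) (e / 2)" using S e by simp
      ultimately obtain d where "d > 0" "ball z d \<subseteq> S \<inter> (\<lambda>p. f'' p a b) -` ball (f'' z a b) (e / 2)"
        by (meson openE)
      then show ?thesis by (intro exI[of _ d]) (auto simp: dist_real_def abs_minus_commute)
    qed
    obtain d1 where d1: "d1 > 0" "ball z d1 \<subseteq> S" "\<forall>p\<in>ball z d1. \<bar>f'' p v w - f'' z v w\<bar> < e / 2"
      using near by blast
    obtain d2 where d2: "d2 > 0" "ball z d2 \<subseteq> S" "\<forall>p\<in>ball z d2. \<bar>f'' p w v - f'' z w v\<bar> < e / 2"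
      using near by blast
    define r where "r = min d1 d2"
    define h where "h = r / (2 * (norm v + norm w + 1))"
    have r: "r > 0" using d1 d2 by (simp add: r_def)
    have pos: "norm v + norm w + 1 > 0" by (simp add: add_nonneg_pos)
    have h: "h > 0" using r pos by (simp add: h_def)
    have hs: "h * (norm v + norm w) < r"
    proof -
      have "h * (norm v + norm w) \<le> h * (norm v + norm w + 1)" using h by simp
      also have "\<dots> = r / 2" using pos by (simp add: h_def field_simps)
      finally show ?thesis using r by linarith
    qed
    have hs': "h * (norm w + norm v) < r" using hs by (simp add: add.commute)
    have sub: "ball z r \<subseteq> S" "ball z r \<subseteq> ball z d1" "ball z r \<subseteq> ball z d2"
      using d1 by (auto simp: r_def)
    obtain p where p: "p \<in> ball z r"
        "f (z + h *\<^sub>R v + h *\<^sub>R w) - f (z + h *\<^sub>R v) - f (z + h *\<^sub>R w) + f z = h\<^sup>2 * f'' p w v"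
      using second_difference_mean_value[of z r f f' f'' h v w] f' f'' h hs sub(1) by blast
    obtain p' where p': "p' \<in> ball z r"
        "f (z + h *\<^sub>R w + h *\<^sub>R v) - f (z + h *\<^sub>R w) - f (z + h *\<^sub>R v) + f z = h\<^sup>2 * f'' p' v w"
      using second_difference_mean_value[of z r f f' f'' h w v] f' f'' h hs' sub(1) by blast
    have "h\<^sup>2 * f'' p w v = h\<^sup>2 * f'' p' v w"
      using p(2) p'(2) by (simp add: algebra_simps)
    then have "f'' p w v = f'' p' v w" using h by simp
    moreover have "\<bar>f'' p' v w - f'' z v w\<bar> < e / 2" "\<bar>f'' p w v - f'' z w v\<bar> < e / 2"
      using d1(3) d2(3) p(1) p'(1) sub by blast+
    ultimately show ?thesis by linarith
  qed
  then have "\<bar>f'' z v w - f'' z w v\<bar> \<le> 0" by (rule field_le_epsilon)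
  then show ?thesis by simp
qed

lemma second_derivative_test:
  fixes \<phi> \<phi>' :: "real \<Rightarrow> real"
  assumes r: "r > 0"
    and \<phi>: "\<And>t. \<bar>t\<bar> < r \<Longrightarrow> DERIV \<phi> t :> \<phi>' t"
    and \<phi>': "DERIV \<phi>' 0 :> d"
    and max: "\<And>t. \<bar>t\<bar> < r \<Longrightarrow> \<phi> t \<le> \<phi> 0"
  shows "d \<le> 0"
proof (rule ccontr)
  assume "\<not> d \<le> 0"
  have 0: "\<phi>' 0 = 0" using DERIV_local_max[of \<phi> "\<phi>' 0" 0 r] \<phi> r max by simp
  obtain \<delta> where \<delta>: "\<delta> > 0" "\<forall>h>0. h < \<delta> \<longrightarrow> \<phi>' 0 < \<phi>' (0 + h)"
    using DERIV_pos_inc_right[OF \<phi>'] \<open>\<not> d \<le> 0\<close> by auto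
  define s where "s = min r \<delta> / 2"
  have s: "0 < s" "s < r" "s < \<delta>" using r \<delta> by (auto simp: s_def)
  have "\<phi> 0 < \<phi> s"
  proof (rule DERIV_pos_imp_increasing_open[OF s(1)])
    show "\<exists>y. DERIV \<phi> x :> y \<and> 0 < y" if "0 < x" "x < s" for x
      using \<phi>[of x] \<delta>(2) that s 0 by (intro exI[of _ "\<phi>' x"]) auto
    show "continuous_on {0..s} \<phi>"
      using s by (intro continuous_at_imp_continuous_on ballI DERIV_isCont[OF \<phi>]) auto
  qed
  then show False using max[of s] s by auto
qed

text \<open>At a maximum the second derivatives of \<open>f\<close> in the directions \<open>1\<close> and \<open>\<i>\<close> are nonpositive, and
their sum, the Laplacian, is \<open>4 l\<close>.\<close>

lemma wirtinger_laplacian_le_0_at_max: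
  fixes f :: "complex \<Rightarrow> real"
  assumes S: "open S" "z \<in> S"
    and f: "\<And>w. w \<in> S \<Longrightarrow> has_wirtinger (\<lambda>w. complex_of_real (f w)) (p w) (cnj (p w)) w"
    and p: "has_wirtinger p a (complex_of_real l) z"
    and max: "\<And>w. w \<in> S \<Longrightarrow> f w \<le> f z"
  shows "l \<le> 0"
proof -
  obtain r where r: "r > 0" "ball z r \<subseteq> S" using S by (meson openE)
  have dir: "2 * Re (a * e\<^sup>2) + 2 * l \<le> 0" if e: "norm e = 1" for e
  proof (rule second_derivative_test[OF r(1)])
    have inS: "z + of_real t * e \<in> S" if "\<bar>t\<bar> < r" for t
      using that e r(2) by (auto simp: dist_norm norm_mult subset_eq)
    show "DERIV (\<lambda>t. f (z + of_real t * e)) t :> 2 * Re (p (z + of_real t * e) * e)" if "\<bar>t\<bar> < r" for t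
    proof -
      note has_wirtinger_line[OF f[OF inS[OF that]]]
      from bounded_linear.has_vector_derivative[OF bounded_linear_Re this]
      show ?thesis by (simp add: has_real_derivative_iff_has_vector_derivative mult.commute)
    qed
    have "has_wirtinger p a (complex_of_real l) (z + of_real 0 * e)" using p by simp
    from has_wirtinger_line[OF this]
    have "((\<lambda>s. 2 * Re (p (z + of_real s * e) * e)) has_real_derivative
        2 * Re ((a * e + of_real l * cnj e) * e)) (at 0)"
      unfolding has_real_derivative_iff_has_vector_derivative
      by (intro has_vector_derivative_mult_right bounded_linear.has_vector_derivative[OF bounded_linear_Re] has_vector_derivative_mult_left)
    moreover have "2 * Re ((a * e + of_real l * cnj e) * e) = 2 * Re (a * e\<^sup>2) + 2 * l"
    proof -
      have "cnj e * e = 1" using e complex_norm_square[of e] by (simp add: mult.commute)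
      then have "(a * e + of_real l * cnj e) * e = a * e\<^sup>2 + of_real l"
        by (simp add: algebra_simps power2_eq_square)
      then show ?thesis by simp
    qed
    ultimately show "DERIV (\<lambda>t. 2 * Re (p (z + of_real t * e) * e)) 0 :> 2 * Re (a * e\<^sup>2) + 2 * l"
      by simp
    show "f (z + of_real t * e) \<le> f (z + of_real 0 * e)" if "\<bar>t\<bar> < r" for t
      using max inS[OF that] by simp
  qed
  show ?thesis using dir[of 1] dir[of \<i>] by simp
qed

text \<open>Adding a small multiple of \<open>|z|\<^sup>2\<close> makes the Laplacian positive, which excludes an interior
maximum.\<close>

lemma subharmonic_le_boundary:
  fixes f :: "complex \<Rightarrow> real"
  assumes S: "open S" "bounded S" and cont: "continuous_on (closure S) f"
    and f: "\<And>w. w \<in> S \<Longrightarrow> has_wirtinger (\<lambda>w. complex_of_real (f w)) (p w) (cnj (p w)) w"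
    and p: "\<And>w. w \<in> S \<Longrightarrow> has_wirtinger p (a w) (complex_of_real (l w)) w"
    and l: "\<And>w. w \<in> S \<Longrightarrow> 0 \<le> l w"
    and bd: "\<And>w. w \<in> frontier S \<Longrightarrow> f w \<le> c"
    and z: "z \<in> S"
  shows "f z \<le> c"
proof (rule ccontr)
  assume "\<not> f z \<le> c"
  obtain M where M: "M > 0" "\<And>w. w \<in> closure S \<Longrightarrow> (norm w)\<^sup>2 \<le> M"
  proof -
    obtain B where "\<forall>w\<in>closure S. norm w \<le> B" using S bounded_closure bounded_iff by metis
    then have "(norm w)\<^sup>2 \<le> B\<^sup>2 + 1" if "w \<in> closure S" for w
      using power_mono[of "norm w" B 2] that by force
    then show ?thesis using that[of "B\<^sup>2 + 1"] by (simp add: add_nonneg_pos)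
  qed
  define e where "e = (f z - c) / (2 * M)"
  have e: "e > 0" "c + e * M < f z"
    using \<open>\<not> f z \<le> c\<close> M by (simp_all add: e_def field_simps)
  define F where "F w = f w + e * (norm w)\<^sup>2" for w
  have cF: "continuous_on (closure S) F" unfolding F_def by (intro continuous_intros cont)
  have "compact (closure S)" "closure S \<noteq> {}" using S z by auto
  then obtain m where m: "m \<in> closure S" "\<And>w. w \<in> closure S \<Longrightarrow> F w \<le> F m"
    using continuous_attains_sup[of "closure S" F] cF by blast
  have "m \<notin> frontier S"
  proof
    assume "m \<in> frontier S"
    then have "F m \<le> c + e * M"
      unfolding F_def using bd M(2)[OF m(1)] e by (intro add_mono mult_left_mono) auto
    moreover have "f z \<le> F z" using e by (simp add: F_def)
    moreover have "F z \<le> F m" using m(2) z closure_subset by blast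
    ultimately show False using e by linarith
  qed
  then have mS: "m \<in> S" using m(1) S(1) by (simp add: frontier_def interior_open)
  have norm_w: "complex_of_real ((norm w)\<^sup>2) = w * cnj w" for w
    by (rule complex_norm_square)
  have "l m + e \<le> 0"
  proof (rule wirtinger_laplacian_le_0_at_max[OF S(1) mS])
    show "has_wirtinger (\<lambda>w. complex_of_real (F w)) (p w + e * cnj w) (cnj (p w + e * cnj w)) w"
      if "w \<in> S" for w
      unfolding F_def of_real_add of_real_mult norm_w
      by (rule has_wirtinger_eqI, (rule has_wirtinger_intros f that)+) simp_all
    show "has_wirtinger (\<lambda>w. p w + e * cnj w) (a m) (complex_of_real (l m + e)) m"
      by (rule has_wirtinger_eqI, (rule has_wirtinger_intros p mS)+) simp_all
    show "F w \<le> F m" if "w \<in> S" for w using m(2) that closure_subset by blast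
  qed
  then show False using l[OF mS] e by linarith
qed

section \<open>Divergences of compactly supported fields\<close>

lemma has_vector_derivative_imp_slope_tendsto:
  assumes "(f has_vector_derivative d) (at 0)"
  shows "((\<lambda>t. (f t - f 0) /\<^sub>R t) \<longlongrightarrow> d) (at 0)"
proof -
  have lim: "((\<lambda>t. norm (f t - f 0 - t *\<^sub>R d) / norm t) \<longlongrightarrow> 0) (at 0)"
    using assms by (simp add: has_vector_derivative_def has_derivative_at)
  have eq: "norm (f t - f 0 - t *\<^sub>R d) / norm t = norm ((f t - f 0) /\<^sub>R t - d)" if "t \<noteq> 0" for t
  proof -
    have "(f t - f 0) /\<^sub>R t - d = (f t - f 0 - t *\<^sub>R d) /\<^sub>R t"
      using that by (simp add: scaleR_diff_right)
    then show ?thesis by (simp add: divide_inverse mult.commute)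
  qed
  have "((\<lambda>t. norm ((f t - f 0) /\<^sub>R t - d)) \<longlongrightarrow> 0) (at 0)"
    by (rule Lim_transform_eventually[OF lim]) (use eq in \<open>auto simp: eventually_at_filter\<close>)
  then have "((\<lambda>t. (f t - f 0) /\<^sub>R t - d) \<longlongrightarrow> 0) (at 0)"
    by (rule tendsto_norm_zero_cancel)
  then show ?thesis by (rule LIM_zero_cancel)
qed

text \<open>The integral of \<open>F\<close> is invariant under translations, so the integrals of its difference quotients
vanish, and they converge to the integrals of its directional derivatives.\<close>

lemma integral_derivative_compact_support:
  fixes F :: "complex \<Rightarrow> complex"
  assumes F: "\<And>z. has_wirtinger F (a z) (b z) z"
    and cont: "continuous_on UNIV a" "continuous_on UNIV b"
    and supp: "\<And>z. norm z > R \<Longrightarrow> F z = 0" "\<And>z. norm z > R \<Longrightarrow> a z = 0" "\<And>z. norm z > R \<Longrightarrow> b z = 0"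
  shows "integrable lborel a" "(\<integral>z. a z \<partial>lborel) = 0"
proof -
  have intg: "integrable lborel f" if "continuous_on UNIV f" "\<And>z. norm z > R \<Longrightarrow> f z = 0"
    for f :: "complex \<Rightarrow> complex"
  proof -
    have "integrable lborel (\<lambda>x. indicator (cball 0 R) x *\<^sub>R f x)"
      by (rule borel_integrable_compact) (use continuous_on_subset[OF that(1)] in auto)
    moreover have "(\<lambda>x. indicator (cball 0 R) x *\<^sub>R f x) = f"
      using that(2) by (auto simp: fun_eq_iff indicator_def)
    ultimately show ?thesis by simp
  qed
  have cF: "continuous_on UNIV F" using F has_wirtinger_imp_continuous_on by blast
  have iF: "integrable lborel F" "integrable lborel a" "integrable lborel b"
    using intg cF cont supp by blast+
  obtain M where M: "M \<ge> 0" "\<And>z. norm (a z) + norm (b z) \<le> M"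
  proof -
    have "compact ((\<lambda>z. norm (a z) + norm (b z)) ` cball 0 R)"
      by (intro compact_continuous_image continuous_intros continuous_on_subset[OF cont(1)]
          continuous_on_subset[OF cont(2)]) auto
    then obtain B where B: "\<forall>z\<in>cball 0 R. norm (norm (a z) + norm (b z)) \<le> B"
      using compact_imp_bounded bounded_iff by (metis (no_types, lifting) imageI)
    have "norm (a z) + norm (b z) \<le> \<bar>B\<bar>" for z
      using B supp(2,3)[of z] by (cases "norm z \<le> R") force+
    then show ?thesis using that[of "\<bar>B\<bar>"] by simp
  qed
  have lip: "norm (F x - F y) \<le> M * norm (x - y)" for x y
  proof (rule differentiable_bound[of UNIV F "\<lambda>z h. a z * h + b z * cnj h"])
    show "onorm (\<lambda>h. a z * h + b z * cnj h) \<le> M" for z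
    proof (rule onorm_le)
      fix h
      have "norm (a z * h + b z * cnj h) \<le> norm (a z) * norm h + norm (b z) * norm h"
        by (intro norm_triangle_le) (simp add: norm_mult)
      also have "\<dots> \<le> M * norm h" using M(2)[of z] by (metis distrib_right mult_right_mono norm_ge_zero)
      finally show "norm (a z * h + b z * cnj h) \<le> M * norm h" .
    qed
  qed (use F in \<open>auto simp: has_wirtinger_def\<close>)
  have dir: "(\<integral>z. a z * e + b z * cnj e \<partial>lborel) = 0" if e: "norm e = 1" for e
  proof -
    define s where "s n z = of_nat (Suc n) * (F (inverse (of_nat (Suc n)) * e + z) - F z)" for n z
    have meas: "F \<in> borel_measurable lborel" using cF borel_measurable_continuous_onI by simp
    have "(\<lambda>n. (\<integral>z. s n z \<partial>lborel)) \<longlonglongrightarrow> (\<integral>z. a z * e + b z * cnj e \<partial>lborel)"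
    proof (rule integral_dominated_convergence[where w = "\<lambda>z. M * indicator (cball 0 (R + 1)) z"])
      show "(\<lambda>z. a z * e + b z * cnj e) \<in> borel_measurable lborel"
        using iF by (intro borel_measurable_add borel_measurable_times) auto
      show "s n \<in> borel_measurable lborel" for n
      proof -
        have "continuous_on UNIV (s n)"
          unfolding s_def by (intro continuous_intros continuous_on_compose2[OF cF]) auto
        then show ?thesis using borel_measurable_continuous_onI by simp
      qed
      show "integrable lborel (\<lambda>z::complex. M * indicator (cball 0 (R + 1)) z)"
        using borel_integrable_compact[of "cball 0 (R + 1)" "\<lambda>z::complex. M"]
        by (simp add: mult.commute)
      show "AE z in lborel. (\<lambda>n. s n z) \<longlonglongrightarrow> a z * e + b z * cnj e"
      proof (rule AE_I2)
        fix z
        have "((\<lambda>t. F (z + of_real t * e)) has_vector_derivative (a z * e + b z * cnj e)) (at 0)"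
          by (rule has_wirtinger_line) (use F in simp)
        from has_vector_derivative_imp_slope_tendsto[OF this]
        have "((\<lambda>t. (F (z + of_real t * e) - F z) /\<^sub>R t) \<longlongrightarrow> a z * e + b z * cnj e) (at 0)"
          by simp
        moreover have "filterlim (\<lambda>n. inverse (real (Suc n))) (at 0) sequentially"
          using LIMSEQ_inverse_real_of_nat by (auto simp: filterlim_at)
        ultimately have "((\<lambda>n. (F (z + of_real (inverse (real (Suc n))) * e) - F z) /\<^sub>R inverse (real (Suc n)))
            \<longlongrightarrow> a z * e + b z * cnj e) sequentially"
          by (rule filterlim_compose)
        then show "(\<lambda>n. s n z) \<longlonglongrightarrow> a z * e + b z * cnj e"
          by (simp add: s_def scaleR_conv_of_real add.commute del: of_nat_Suc)
      qed
      show "AE z in lborel. norm (s n z) \<le> M * indicator (cball 0 (R + 1)) z" for n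
      proof (rule AE_I2)
        fix z
        show "norm (s n z) \<le> M * indicator (cball 0 (R + 1)) z"
        proof (cases "norm z \<le> R + 1")
          case True
          have "norm (s n z) \<le> real (Suc n) * (M * norm (inverse (of_nat (Suc n)) * e + z - z))"
            unfolding s_def norm_mult norm_of_nat by (intro mult_left_mono lip) simp
          also have "\<dots> = M" using e by (simp add: norm_mult norm_inverse del: of_nat_Suc)
          finally show ?thesis using True by simp
        next
          case False
          have "norm (inverse (complex_of_nat (Suc n)) * e) = inverse (real (Suc n))"
            using e by (simp only: norm_mult norm_inverse norm_of_nat mult_1_right)
          also have "\<dots> \<le> 1" by (simp add: field_simps)
          finally have "norm (inverse (of_nat (Suc n)) * e + z) > R"
            using False norm_diff_ineq[of z "inverse (of_nat (Suc n)) * e"] by (simp add: add.commute)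
          then show ?thesis using False supp(1) by (simp add: s_def)
        qed
      qed
    qed
    moreover have s0: "(\<integral>z. s n z \<partial>lborel) = 0" for n
    proof -
      let ?w = "inverse (complex_of_nat (Suc n)) * e"
      have 1: "integrable lborel (\<lambda>z. F (?w + z))"
        using integrable_distr[of "(+) ?w" lborel borel F] iF(1) by (simp add: lborel_distr_plus)
      have 2: "(\<integral>z. F (?w + z) \<partial>lborel) = (\<integral>z. F z \<partial>lborel)"
        using integral_distr[of "(+) ?w" lborel borel F] meas by (simp add: lborel_distr_plus)
      show ?thesis unfolding s_def using 1 2 iF(1) by simp
    qed
    ultimately have "(\<lambda>n. 0) \<longlonglongrightarrow> (\<integral>z. a z * e + b z * cnj e \<partial>lborel)"
      by (simp only: s0)
    then show ?thesis by (simp add: LIMSEQ_const_iff)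
  qed
  have "(\<integral>z. a z \<partial>lborel) + (\<integral>z. b z \<partial>lborel) = 0" using dir[of 1] iF by simp
  moreover have "(\<integral>z. a z \<partial>lborel) * \<i> - (\<integral>z. b z \<partial>lborel) * \<i> = 0"
    using dir[of \<i>] iF by simp
  then have "(\<integral>z. a z \<partial>lborel) = (\<integral>z. b z \<partial>lborel)" by simp
  ultimately show "(\<integral>z. a z \<partial>lborel) = 0" by simp
  show "integrable lborel a" by fact
qed

text \<open>The real part of \<open>2 a\<close> is the divergence of the field \<open>F\<close>, so this is the divergence theorem without
boundary term.\<close>

lemma integral_derivative_compact_support_on:
  fixes F :: "complex \<Rightarrow> complex"
  assumes S: "open S" and K: "compact K" "K \<subseteq> S"
    and F: "\<And>z. z \<in> S \<Longrightarrow> has_wirtinger F (a z) (b z) z"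
    and cont: "continuous_on S a" "continuous_on S b"
    and supp: "\<And>z. z \<in> S - K \<Longrightarrow> F z = 0 \<and> a z = 0 \<and> b z = 0"
  shows "integrable lborel (\<lambda>z. if z \<in> S then a z else 0)"
    "(\<integral>z. (if z \<in> S then a z else 0) \<partial>lborel) = 0"
proof -
  define ext where "ext f z = (if z \<in> S then f z else 0)" for f :: "complex \<Rightarrow> complex" and z
  have opK: "open (- K)" using K compact_imp_closed by auto
  have U: "S \<union> - K = UNIV" using K by auto
  have zero: "ext f z = 0" if "z \<in> - K" "f = F \<or> f = a \<or> f = b" for f z
    using that supp[of z] by (auto simp: ext_def)
  have cext: "continuous_on UNIV (ext f)" if "continuous_on S f" "f = F \<or> f = a \<or> f = b" for f
  proof -
    have "continuous_on S (ext f)"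
      using that(1) by (rule continuous_on_eq) (simp add: ext_def)
    moreover have "continuous_on (- K) (ext f)"
      by (rule continuous_on_eq[OF continuous_on_const[of _ 0]]) (use zero that(2) in auto)
    ultimately show ?thesis using continuous_on_open_Un[OF S opK] U by metis
  qed
  have w: "has_wirtinger (ext F) (ext a z) (ext b z) z" for z
  proof (cases "z \<in> S")
    case True
    have "has_wirtinger (ext F) (a z) (b z) z"
      by (rule has_wirtinger_transform_open[OF F[OF True] S True]) (simp add: ext_def)
    then show ?thesis using True by (simp add: ext_def)
  next
    case False
    then have "z \<in> - K" using K by auto
    have "has_wirtinger (ext F) 0 0 z"
      by (rule has_wirtinger_transform_open[OF has_wirtinger_const[of 0] opK \<open>z \<in> - K\<close>])
         (use zero in auto)
    then show ?thesis using False by (simp add: ext_def)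
  qed
  obtain R where R: "\<And>z. z \<in> K \<Longrightarrow> norm z \<le> R"
    using compact_imp_bounded[OF K(1)] bounded_iff by metis
  have out: "ext f z = 0" if "norm z > R" "f = F \<or> f = a \<or> f = b" for f z
    using zero[of z f] R[of z] that by auto
  have "integrable lborel (ext a)" "(\<integral>z. ext a z \<partial>lborel) = 0"
    using integral_derivative_compact_support[of "ext F" "ext a" "ext b" R] w
      cext[OF cont(1)] cext[OF cont(2)] out by blast+
  then show "integrable lborel (\<lambda>z. if z \<in> S then a z else 0)"
    "(\<integral>z. (if z \<in> S then a z else 0) \<partial>lborel) = 0"
    by (simp_all add: ext_def[abs_def])
qed

lemma smooth_step_exists:
  "\<exists>\<phi> \<phi>' :: real \<Rightarrow> real. (\<forall>s. DERIV \<phi> s :> \<phi>' s) \<and> continuous_on UNIV \<phi>' \<and>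
     (\<forall>s. 0 \<le> \<phi>' s) \<and> (\<forall>s. 0 \<le> \<phi> s \<and> \<phi> s \<le> 1) \<and> (\<forall>s\<le>1. \<phi> s = 0 \<and> \<phi>' s = 0) \<and>
     (\<forall>s\<ge>2. \<phi> s = 1 \<and> \<phi>' s = 0)"
proof -
  define m where "m = (\<lambda>s::real. max 0 s)"
  have sq: "DERIV (\<lambda>s. (m s)\<^sup>2) s :> 2 * m s" for s
  proof (cases s "0::real" rule: linorder_cases)
    case less
    have "DERIV (\<lambda>s. 0) s :> (0::real)" by simp
    moreover have "\<forall>\<^sub>F x in nhds s. (m x)\<^sup>2 = 0"
      using less eventually_nhds_in_open[of "{..<0}" s] by (auto elim!: eventually_mono simp: m_def)
    ultimately have "DERIV (\<lambda>s. (m s)\<^sup>2) s :> 0"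
      by (subst DERIV_cong_ev[of s s _ "\<lambda>s. 0"]) auto
    then show ?thesis using less by (simp add: m_def)
  next
    case greater
    have "DERIV (\<lambda>s. s\<^sup>2) s :> 2 * s" by (auto intro!: derivative_eq_intros)
    moreover have "\<forall>\<^sub>F x in nhds s. (m x)\<^sup>2 = x\<^sup>2"
      using greater eventually_nhds_in_open[of "{0<..}" s] by (auto elim!: eventually_mono simp: m_def)
    ultimately have "DERIV (\<lambda>s. (m s)\<^sup>2) s :> 2 * s"
      by (subst DERIV_cong_ev[of s s _ "\<lambda>s. s\<^sup>2"]) auto
    then show ?thesis using greater by (simp add: m_def)
  next
    case equal
    have "((\<lambda>h. (m h)\<^sup>2 / h) \<longlongrightarrow> 0) (at 0)"
    proof (rule Lim_null_comparison)
      show "\<forall>\<^sub>F h in at 0. norm ((m h)\<^sup>2 / h) \<le> \<bar>h\<bar>"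
        by (auto simp: m_def max_def power2_eq_square)
      show "((\<lambda>h::real. \<bar>h\<bar>) \<longlongrightarrow> 0) (at 0)" by (auto intro: tendsto_rabs_zero)
    qed
    then show ?thesis using equal by (simp add: DERIV_def m_def)
  qed
  \<comment> \<open>The numerator and both terms of the denominator are squares of positive parts, which are
    continuously differentiable, and the denominator has no zero.\<close>
  define D where "D s = (m (s - 1))\<^sup>2 + (m (2 - s))\<^sup>2" for s
  have Dpos: "D s > 0" for s
    by (cases "s > 1") (auto simp: D_def m_def add_pos_nonneg add_nonneg_pos)
  define \<phi> where "\<phi> s = (m (s - 1))\<^sup>2 / D s" for s
  define \<phi>' where "\<phi>' s = 2 * m (s - 1) * m (2 - s) * (m (s - 1) + m (2 - s)) / (D s)\<^sup>2" for s
  have d1: "DERIV (\<lambda>s. (m (s - 1))\<^sup>2) s :> 2 * m (s - 1)" for s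
  proof -
    have "DERIV (\<lambda>s. s - 1) s :> (1::real)" by (auto intro!: derivative_eq_intros)
    from DERIV_chain2[OF sq this] show ?thesis by simp
  qed
  have d2: "DERIV (\<lambda>s. (m (2 - s))\<^sup>2) s :> - 2 * m (2 - s)" for s
  proof -
    have "DERIV (\<lambda>s. 2 - s) s :> (- 1::real)" by (auto intro!: derivative_eq_intros)
    from DERIV_chain2[OF sq this] show ?thesis by simp
  qed
  have "DERIV \<phi> s :> \<phi>' s" for s
  proof -
    have "D s \<noteq> 0" using Dpos[of s] by simp
    have "DERIV \<phi> s :> (2 * m (s - 1) * D s - (m (s - 1))\<^sup>2 * (2 * m (s - 1) + - 2 * m (2 - s))) / (D s * D s)"
      unfolding \<phi>_def using \<open>D s \<noteq> 0\<close> unfolding D_def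
      by (intro DERIV_divide DERIV_add d1 d2)
    moreover have "2 * m (s - 1) * D s - (m (s - 1))\<^sup>2 * (2 * m (s - 1) + - 2 * m (2 - s))
        = 2 * m (s - 1) * m (2 - s) * (m (s - 1) + m (2 - s))"
      by (simp add: D_def algebra_simps power2_eq_square)
    ultimately show ?thesis by (simp add: \<phi>'_def power2_eq_square)
  qed
  moreover have "continuous_on UNIV \<phi>'"
    using Dpos unfolding \<phi>'_def D_def m_def
    by (intro continuous_intros) (auto simp: less_imp_neq[symmetric] D_def m_def)
  moreover have "0 \<le> \<phi>' s" "0 \<le> \<phi> s" "\<phi> s \<le> 1" for s
    using Dpos[of s] by (auto simp: \<phi>'_def \<phi>_def D_def m_def)
  moreover have "\<phi> s = 0" "\<phi>' s = 0" if "s \<le> 1" for s using that by (auto simp: \<phi>_def \<phi>'_def m_def)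
  moreover have "\<phi> s = 1" "\<phi>' s = 0" if "s \<ge> 2" for s
    using that Dpos[of s] by (auto simp: \<phi>_def \<phi>'_def m_def D_def)
  ultimately show ?thesis by blast
qed

section \<open>The Hopf differential and the P-function\<close>

text \<open>The hyperbolic metric is \<open>4 |dz|\<^sup>2 / conf\<^sup>2\<close>.\<close>

definition conf :: "complex \<Rightarrow> complex" where
  "conf z = 1 - z * cnj z"

lemma conf_of_real: "conf z = complex_of_real (1 - (norm z)\<^sup>2)"
  by (simp only: conf_def complex_norm_square of_real_diff of_real_1)

lemma cnj_conf [simp]: "cnj (conf z) = conf z"
  by (simp add: conf_def mult.commute)

lemma conf_pos: "norm z < 1 \<Longrightarrow> 0 < 1 - (norm z)\<^sup>2"
  by (simp add: power_less_one_iff)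

lemma conf_nonzero: "norm z < 1 \<Longrightarrow> conf z \<noteq> 0"
  using conf_pos[of z] unfolding conf_of_real by (metis of_real_eq_0_iff less_irrefl)

lemma has_wirtinger_conf: "has_wirtinger conf (- cnj z) (- z) z"
  unfolding conf_def[abs_def]
  by (rule has_wirtinger_eqI, (rule has_wirtinger_intros)+) simp_all

lemma cosh_hyp_dist:
  assumes "norm m < 1" "norm z < 1"
  shows "cosh (hyp_dist m z) = 1 + 2 * (norm (m - z))\<^sup>2 / ((1 - (norm m)\<^sup>2) * (1 - (norm z)\<^sup>2))"
  unfolding hyp_dist_def using conf_pos[OF assms(1)] conf_pos[OF assms(2)]
  by (subst cosh_arcosh_real) auto

text \<open>Here \<open>g\<close> is \<open>\<partial>\<^sub>z u\<close> and \<open>A\<close> is its derivative \<open>\<partial>\<^sub>z\<partial>\<^sub>z u\<close>. The mixed derivative in \<open>dg\<close> expresses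
the equation \<open>\<Delta>u = 2u\<close>.\<close>

locale hyperbolic_solution =
  fixes S :: "complex set" and u :: "complex \<Rightarrow> real" and g A :: "complex \<Rightarrow> complex"
  assumes open_S: "open S" and S_disk: "S \<subseteq> ball 0 1"
    and du: "z \<in> S \<Longrightarrow> has_wirtinger (\<lambda>z. complex_of_real (u z)) (g z) (cnj (g z)) z"
    and dg: "z \<in> S \<Longrightarrow> has_wirtinger g (A z) (2 * complex_of_real (u z) / (conf z)\<^sup>2) z"
    and cont_A: "continuous_on S A"
begin

text \<open>The component \<open>(2,0)\<close> of the trace-free Hessian: the subtracted term is the Christoffel
correction.\<close>

definition hopf :: "complex \<Rightarrow> complex" where
  "hopf z = A z - 2 * cnj z * g z / conf z"

text \<open>The squared hyperbolic norm of the gradient of \<open>u\<close> is \<open>conf\<^sup>2 |g|\<^sup>2\<close>.\<close>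

definition P_fun :: "complex \<Rightarrow> real" where
  "P_fun z = (1 - (norm z)\<^sup>2)\<^sup>2 * (norm (g z))\<^sup>2 - (u z)\<^sup>2"

lemma norm_S: "z \<in> S \<Longrightarrow> norm z < 1"
  using S_disk by auto

lemma conf_S: "z \<in> S \<Longrightarrow> conf z \<noteq> 0"
  using norm_S conf_nonzero by blast

lemma cont_u: "continuous_on S u"
  using continuous_on_Re[OF has_wirtinger_imp_continuous_on[OF du]] by simp

lemma cont_g: "continuous_on S g"
  by (rule has_wirtinger_imp_continuous_on[OF dg])

lemma cont_conf: "continuous_on X conf"
  unfolding conf_def[abs_def] by (intro continuous_intros)

lemmas wirtinger_S = has_wirtinger_intros has_wirtinger_conf du dg

text \<open>As \<open>u\<close> is only twice differentiable, \<open>hopf\<close> cannot be differentiated directly. But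
\<open>hopf dz = dg - (k dz + h d\<zeta>)\<close> with \<open>k = 2 \<zeta> g / conf\<close> and \<open>h = 2u / conf\<^sup>2\<close>, and the equation
makes the form on the right closed. If \<open>G\<close> is a local primitive of it, then \<open>g - G\<close> is complex
differentiable with derivative \<open>hopf\<close>.\<close>

lemma hopf_holomorphic:
  assumes z: "z \<in> S"
  shows "\<exists>q'. has_wirtinger hopf q' 0 z"
proof -
  obtain r where r: "r > 0" "ball z r \<subseteq> S" using open_S z by (meson openE)
  define k where "k w = 2 * cnj w * g w / conf w" for w
  define h where "h w = 2 * complex_of_real (u w) / (conf w)\<^sup>2" for w
  define k1 where "k1 w = 2 * cnj w * (A w * conf w + g w * cnj w) / (conf w)\<^sup>2" for w
  define k2 where "k2 w = 2 * g w / (conf w)\<^sup>2 + 4 * cnj w * complex_of_real (u w) / (conf w)^3" for w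
  define h2 where "h2 w = 2 * cnj (g w) / (conf w)\<^sup>2 + 4 * w * complex_of_real (u w) / (conf w)^3" for w
  have B: "w \<in> S" if "w \<in> ball z r" for w using that r by blast
  have wk: "has_wirtinger k (k1 w) (k2 w) w" if "w \<in> ball z r" for w
  proof -
    have nz: "conf w \<noteq> 0" using conf_S B that by blast
    have zz: "w * cnj w = 1 - conf w" by (simp add: conf_def)
    show ?thesis unfolding k_def
      apply (rule has_wirtinger_eqI, (rule wirtinger_S B that nz)+)
      subgoal using nz by (simp add: k1_def algebra_simps)
      subgoal using nz zz apply (simp add: k2_def divide_simps power2_eq_square power3_eq_cube) by algebra
      done
  qed
  have wh: "has_wirtinger h (k2 w) (h2 w) w" if "w \<in> ball z r" for w
  proof -
    have nz: "conf w \<noteq> 0" using conf_S B that by blast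
    have zz: "w * cnj w = 1 - conf w" by (simp add: conf_def)
    show ?thesis unfolding h_def
      apply (rule has_wirtinger_eqI, (rule wirtinger_S B that | simp add: nz)+)
      subgoal using nz by (simp add: k2_def divide_simps power2_eq_square power3_eq_cube power4_eq_xxxx algebra_simps)
      subgoal using nz by (simp add: h2_def divide_simps power2_eq_square power3_eq_cube algebra_simps)
      done
  qed
  have "continuous_on (ball z r) k1" "continuous_on (ball z r) k2" "continuous_on (ball z r) h2"
    unfolding k1_def k2_def h2_def
    by (intro continuous_intros continuous_on_subset[OF cont_A r(2)] continuous_on_subset[OF cont_g r(2)]
        continuous_on_subset[OF cont_u r(2)] cont_conf; use conf_S B in force)+
  then obtain G where G: "\<And>w. w \<in> ball z r \<Longrightarrow> has_wirtinger G (k w) (h w) w"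
    using wirtinger_poincare_ball[OF r(1) wk wh] by blast
  have fd: "((\<lambda>w. g w - G w) has_field_derivative hopf w) (at w)" if "w \<in> ball z r" for w
    using has_wirtinger_diff[OF dg[OF B[OF that]] G[OF that]]
    by (simp add: has_wirtinger_def has_field_derivative_def hopf_def k_def h_def)
  then have "(\<lambda>w. g w - G w) holomorphic_on ball z r"
    by (meson holomorphic_on_open open_ball)
  then have "deriv (\<lambda>w. g w - G w) holomorphic_on ball z r"
    by (rule holomorphic_deriv) simp
  then obtain q' where "(deriv (\<lambda>w. g w - G w) has_field_derivative q') (at z)"
    using r(1) by (meson centre_in_ball holomorphic_on_open open_ball)
  from has_wirtinger_holomorphic[OF this]
  have "has_wirtinger hopf q' 0 z"
    by (rule has_wirtinger_transform_open[where S = "ball z r"])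
       (use r(1) in \<open>auto intro!: DERIV_imp_deriv fd\<close>)
  then show ?thesis by blast
qed

lemma d_P_fun:
  assumes z: "z \<in> S"
  shows "has_wirtinger (\<lambda>z. complex_of_real (P_fun z))
      ((conf z)\<^sup>2 * hopf z * cnj (g z)) (cnj ((conf z)\<^sup>2 * hopf z * cnj (g z))) z"
proof -
  have eq: "complex_of_real (P_fun w) = (conf w)\<^sup>2 * (g w * cnj (g w)) - (complex_of_real (u w))\<^sup>2" for w
    unfolding P_fun_def conf_of_real of_real_diff of_real_mult of_real_power of_real_1
    by (simp only: complex_norm_square[symmetric] of_real_power)
  have nz: "conf z \<noteq> 0" using conf_S z by blast
  show ?thesis unfolding eq
    apply (rule has_wirtinger_eqI, (rule wirtinger_S z)+)
    subgoal using nz by (simp add: hopf_def divide_simps power2_eq_square algebra_simps)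
    subgoal using nz by (simp add: hopf_def divide_simps power2_eq_square algebra_simps)
    done
qed

text \<open>Since \<open>hopf\<close> is holomorphic, only \<open>conf\<^sup>2 cnj g\<close> contributes, and its derivative with
respect to \<open>\<zeta>\<close> is \<open>conf\<^sup>2 cnj hopf\<close>.\<close>

lemma laplacian_P_fun:
  assumes z: "z \<in> S"
  shows "\<exists>a. has_wirtinger (\<lambda>z. (conf z)\<^sup>2 * hopf z * cnj (g z)) a
      (complex_of_real ((1 - (norm z)\<^sup>2)\<^sup>2 * (norm (hopf z))\<^sup>2)) z"
proof -
  obtain q' where q': "has_wirtinger hopf q' 0 z" using hopf_holomorphic[OF z] by blast
  have eq: "complex_of_real ((1 - (norm z)\<^sup>2)\<^sup>2 * (norm (hopf z))\<^sup>2) = (conf z)\<^sup>2 * (hopf z * cnj (hopf z))"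
    unfolding conf_of_real of_real_diff of_real_mult of_real_power of_real_1
    by (simp only: complex_norm_square[symmetric] of_real_power)
  have nz: "conf z \<noteq> 0" using conf_S z by blast
  show ?thesis unfolding eq
    apply (rule exI)
    apply (rule has_wirtinger_eqI, (rule wirtinger_S z q')+)
     apply (rule refl)
    subgoal using nz by (simp add: hopf_def divide_simps power2_eq_square algebra_simps)
    done
qed

text \<open>If the trace-free Hessian vanishes, then \<open>u conf = \<alpha> (1 + |z|\<^sup>2) + 2 Re (\<beta> z)\<close> with constants
\<open>\<alpha>\<close> and \<open>\<beta>\<close>: in the hyperboloid model this is a linear function. Solving for \<open>\<alpha>\<close> and \<open>\<beta>\<close> in
terms of \<open>u\<close> and \<open>g\<close> gives two expressions whose derivatives vanish, and they are evaluated at the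
critical point \<open>m\<close>.\<close>

lemma radial_of_hopf_zero:
  assumes conn: "connected S" and q0: "\<And>z. z \<in> S \<Longrightarrow> hopf z = 0"
    and m: "m \<in> S" "g m = 0" and z: "z \<in> S"
  shows "u z = u m * cosh (hyp_dist m z)"
proof -
  define V where "V w = 2 / conf w - 1" for w
  define \<alpha> where "\<alpha> w = complex_of_real (u w) * V w - w * g w - cnj w * cnj (g w)" for w
  define \<beta> where "\<beta> w = g w + (cnj w)\<^sup>2 * cnj (g w) - 2 * complex_of_real (u w) * cnj w / conf w" for w
  have Aeq: "A w = 2 * cnj w * g w / conf w" if "w \<in> S" for w
    using q0[OF that] by (simp add: hopf_def)
  have nz: "conf w \<noteq> 0" if "w \<in> S" for w using conf_S that by blast
  have zz: "w * cnj w = 1 - conf w" for w by (simp add: conf_def)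
  have d\<alpha>: "has_wirtinger \<alpha> 0 0 w" if w: "w \<in> S" for w
    unfolding \<alpha>_def V_def
    apply (rule has_wirtinger_eqI, (rule wirtinger_S w nz)+)
    subgoal using nz[OF w] zz[of w] apply (simp add: Aeq[OF w] divide_simps power2_eq_square) by algebra
    subgoal using nz[OF w] zz[of w] apply (simp add: Aeq[OF w] divide_simps power2_eq_square) by algebra
    done
  have d\<beta>: "has_wirtinger \<beta> 0 0 w" if w: "w \<in> S" for w
    unfolding \<beta>_def
    apply (rule has_wirtinger_eqI, (rule wirtinger_S w nz)+)
    subgoal using nz[OF w] zz[of w] by (simp add: Aeq[OF w] divide_simps power2_eq_square)
    subgoal using nz[OF w] zz[of w] apply (simp add: Aeq[OF w] divide_simps power2_eq_square) by algebra
    done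
  have ab: "\<alpha> z = \<alpha> m" "\<beta> z = \<beta> m"
    using has_wirtinger_zero_imp_constant[OF open_S conn] d\<alpha> d\<beta> z m(1) by blast+
  have "complex_of_real (u z) * conf z = \<alpha> z * (1 + z * cnj z) + \<beta> z * z + cnj (\<beta> z * z)"
    using nz[OF z] zz[of z] apply (simp add: \<alpha>_def \<beta>_def V_def divide_simps power2_eq_square)
    by algebra
  also have "\<dots> = complex_of_real (u m) * ((2 / conf m - 1) * (1 + z * cnj z)
      - 2 * (cnj m * z + m * cnj z) / conf m)"
    unfolding ab by (simp add: \<alpha>_def \<beta>_def V_def m(2) algebra_simps add_divide_distrib)
  finally have X: "complex_of_real (u z) * conf z = complex_of_real (u m) * ((2 / conf m - 1) * (1 + z * cnj z)
      - 2 * (cnj m * z + m * cnj z) / conf m)" .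
  have Y: "((2 / conf m - 1) * (1 + z * cnj z) - 2 * (cnj m * z + m * cnj z) / conf m) * conf m
      = (2 - conf m) * (1 + z * cnj z) - 2 * (cnj m * z + m * cnj z)"
    using nz[OF m(1)] by (simp add: left_diff_distrib)
  have uz: "complex_of_real (u z) * conf z * conf m = complex_of_real (u m) * ((2 - conf m) * (1 + z * cnj z)
      - 2 * (cnj m * z + m * cnj z))"
    by (simp only: X mult.assoc Y)
  note c1 = cosh_hyp_dist[OF norm_S[OF m(1)] norm_S[OF z]]
  have "complex_of_real (cosh (hyp_dist m z)) = 1 + 2 * ((m - z) * cnj (m - z)) / (conf m * conf z)"
    unfolding c1 conf_of_real complex_norm_square[symmetric] by simp
  then have "complex_of_real (cosh (hyp_dist m z)) * (conf m * conf z) =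
      conf m * conf z + 2 * ((m - z) * cnj (m - z))"
    using nz[OF m(1)] nz[OF z] by (simp add: field_simps)
  then have "complex_of_real (u m * cosh (hyp_dist m z)) * (conf m * conf z)
     = complex_of_real (u z) * (conf m * conf z)"
    using uz zz[of z] zz[of m] apply simp by algebra
  then have "complex_of_real (u m * cosh (hyp_dist m z)) = complex_of_real (u z)"
    using nz[OF m(1)] nz[OF z] by (simp only: mult_cancel_right) simp
  then show ?thesis using of_real_eq_iff by metis
qed

end

section \<open>The Dirichlet problem and the overdetermined problem\<close>

locale hyperbolic_dirichlet = hyperbolic_solution +
  fixes a :: real
  assumes closure_disk: "closure S \<subseteq> ball 0 1" and nonempty: "S \<noteq> {}"
    and a_nonneg: "a \<ge> 0"
    and u_closure: "continuous_on (closure S) u"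
    and u_frontier: "z \<in> frontier S \<Longrightarrow> u z = a"
begin

lemma bounded_S: "bounded S"
  using S_disk bounded_subset bounded_ball by blast

lemma compact_closure_S: "compact (closure S)"
  using bounded_S by simp

lemma conf_closure: "z \<in> closure S \<Longrightarrow> 0 < 1 - (norm z)\<^sup>2"
  using closure_disk by (intro conf_pos) auto

lemma closure_cases: "z \<in> closure S \<Longrightarrow> z \<notin> frontier S \<Longrightarrow> z \<in> S"
  using open_S by (simp add: frontier_def interior_open)

lemma laplacian_u:
  "2 * complex_of_real (u z) / (conf z)\<^sup>2 = complex_of_real (2 * u z / (1 - (norm z)\<^sup>2)\<^sup>2)"
  by (simp add: conf_of_real)

lemma u_nonneg:
  assumes z: "z \<in> S"
  shows "0 \<le> u z"
proof (rule ccontr)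
  assume neg: "\<not> 0 \<le> u z"
  obtain m where m: "m \<in> closure S" "\<And>w. w \<in> closure S \<Longrightarrow> u m \<le> u w"
    using continuous_attains_inf[OF compact_closure_S _ u_closure] nonempty by auto
  have um: "u m < 0" using m(2)[of z] z closure_subset neg by fastforce
  then have mS: "m \<in> S" using closure_cases m(1) u_frontier a_nonneg by force
  have "- (2 * u m / (1 - (norm m)\<^sup>2)\<^sup>2) \<le> 0"
  proof (rule wirtinger_laplacian_le_0_at_max[OF open_S mS])
    show "has_wirtinger (\<lambda>w. complex_of_real (- u w)) (- g w) (cnj (- g w)) w" if "w \<in> S" for w
      using has_wirtinger_minus[OF du[OF that]] by simp
    show "has_wirtinger (\<lambda>w. - g w) (- A m) (complex_of_real (- (2 * u m / (1 - (norm m)\<^sup>2)\<^sup>2))) m"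
      using has_wirtinger_minus[OF dg[OF mS]] unfolding laplacian_u by simp
    show "- u w \<le> - u m" if "w \<in> S" for w using m(2) closure_subset that by auto
  qed
  moreover have "2 * u m / (1 - (norm m)\<^sup>2)\<^sup>2 < 0"
    using um conf_closure[OF m(1)] by (intro divide_neg_pos) auto
  ultimately show False by simp
qed

lemma u_less:
  assumes a_pos: "a > 0" and z: "z \<in> S"
  shows "u z < a"
proof -
  have le: "u w \<le> a" if "w \<in> S" for w
    using subharmonic_le_boundary[OF open_S bounded_S u_closure du dg[unfolded laplacian_u] _ _ that]
      u_nonneg u_frontier by simp
  have "u z \<noteq> a"
  proof
    assume uz: "u z = a"
    have "2 * u z / (1 - (norm z)\<^sup>2)\<^sup>2 \<le> 0"
      using wirtinger_laplacian_le_0_at_max[OF open_S z du dg[OF z, unfolded laplacian_u]] le uz by simp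
    moreover have "2 * u z / (1 - (norm z)\<^sup>2)\<^sup>2 > 0"
      using uz a_pos conf_closure[of z] z closure_subset by (intro divide_pos_pos) fastforce+
    ultimately show False by simp
  qed
  then show ?thesis using le[OF z] by simp
qed

end

text \<open>The function \<open>g\<close> is the continuous extension of \<open>\<partial>\<^sub>z u\<close> to the closure. The overdetermined
condition takes the form that the gradient has hyperbolic length \<open>|b|\<close> on the frontier.\<close>

locale hyperbolic_overdetermined = hyperbolic_dirichlet +
  fixes b :: real
  assumes a_pos: "a > 0"
    and g_closure: "continuous_on (closure S) g"
    and g_frontier: "z \<in> frontier S \<Longrightarrow> (1 - (norm z)\<^sup>2)\<^sup>2 * (norm (g z))\<^sup>2 = b\<^sup>2"
begin

lemma P_fun_closure: "continuous_on (closure S) P_fun"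
  unfolding P_fun_def[abs_def] by (intro continuous_intros u_closure g_closure)

lemma P_fun_le:
  assumes z: "z \<in> S"
  shows "P_fun z \<le> b\<^sup>2 - a\<^sup>2"
proof -
  obtain l where l: "\<And>w. w \<in> S \<Longrightarrow> has_wirtinger (\<lambda>z. (conf z)\<^sup>2 * hopf z * cnj (g z)) (l w)
      (complex_of_real ((1 - (norm w)\<^sup>2)\<^sup>2 * (norm (hopf w))\<^sup>2)) w"
    using laplacian_P_fun by metis
  show ?thesis
    by (rule subharmonic_le_boundary[OF open_S bounded_S P_fun_closure d_P_fun l _ _ z])
       (simp_all add: P_fun_def g_frontier u_frontier)
qed

text \<open>For \<open>b = 0\<close> the bound on \<open>P\<close> would give \<open>u\<^sup>2 \<ge> a\<^sup>2\<close> in the domain.\<close>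

lemma b_nonzero: "b \<noteq> 0"
proof
  assume b: "b = 0"
  obtain z where z: "z \<in> S" using nonempty by auto
  have "- (u z)\<^sup>2 \<le> P_fun z" by (simp add: P_fun_def)
  then have "a\<^sup>2 \<le> (u z)\<^sup>2" using P_fun_le[OF z] b by simp
  then have "a \<le> u z" using u_nonneg[OF z] by (rule power2_le_imp_le)
  then show False using u_less[OF a_pos z] by simp
qed

section \<open>The Pohozaev identity\<close>

text \<open>This is \<open>cosh r\<close> for the distance \<open>r\<close> from the origin.\<close>

definition cosh_origin :: "complex \<Rightarrow> complex" where
  "cosh_origin z = 2 / conf z - 1"

definition radial_coeff :: "complex \<Rightarrow> complex" where
  "radial_coeff z = complex_of_real (3 / 2 * (u z)\<^sup>2 + (b\<^sup>2 - a\<^sup>2) / 2 - a * u z)"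

text \<open>In Euclidean coordinates the field is
\<open>V u Du + \<langle>z, Du\<rangle> Du - |Du|\<^sup>2 z / 2 - (4 / conf\<^sup>2) (3u\<^sup>2/2 + c/2 - a u) z - a V Du\<close>
with \<open>V = cosh r\<close>, \<open>c = b\<^sup>2 - a\<^sup>2\<close> and \<open>Du = 2 cnj g\<close>. The first term is Green's, the next
two are Pohozaev's for the conformal field \<open>z\<close>, and the coefficients of the others make the
product with \<open>Du\<close> vanish where \<open>u = a\<close> and \<open>|Du| = 2|b| / conf\<close>.\<close>

definition pohozaev :: "complex \<Rightarrow> complex" where
  "pohozaev z = 2 * cosh_origin z * (complex_of_real (u z) - a) * cnj (g z) + 2 * cnj z * (cnj (g z))\<^sup>2
     - 4 * radial_coeff z * z / (conf z)\<^sup>2"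

definition pohozaev_z :: "complex \<Rightarrow> complex" where
  "pohozaev_z z = 4 * cnj z / (conf z)\<^sup>2 * (complex_of_real (u z) - a) * cnj (g z) + 2 * cosh_origin z * g z * cnj (g z)
     + (2 * cosh_origin z * (complex_of_real (u z) - a) + 4 * cnj z * cnj (g z)) * (2 * complex_of_real (u z) / (conf z)\<^sup>2)
     - 8 * z * cnj z * radial_coeff z / (conf z)^3
     - 4 * (3 * complex_of_real (u z) - a) * g z * z / (conf z)\<^sup>2 - 4 * radial_coeff z / (conf z)\<^sup>2"

definition pohozaev_zbar :: "complex \<Rightarrow> complex" where
  "pohozaev_zbar z = 4 * z / (conf z)\<^sup>2 * (complex_of_real (u z) - a) * cnj (g z) + 2 * cosh_origin z * (cnj (g z))\<^sup>2
     + (2 * cosh_origin z * (complex_of_real (u z) - a) + 4 * cnj z * cnj (g z)) * cnj (A z) + 2 * (cnj (g z))\<^sup>2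
     - 8 * z\<^sup>2 * radial_coeff z / (conf z)^3
     - 4 * (3 * complex_of_real (u z) - a) * cnj (g z) * z / (conf z)\<^sup>2"

lemma d_pohozaev:
  assumes z: "z \<in> S"
  shows "has_wirtinger pohozaev (pohozaev_z z) (pohozaev_zbar z) z"
proof -
  have nz: "conf z \<noteq> 0" using conf_S z by blast
  have dV: "has_wirtinger cosh_origin (2 * cnj z / (conf z)\<^sup>2) (2 * z / (conf z)\<^sup>2) z"
    unfolding cosh_origin_def[abs_def]
    by (rule has_wirtinger_eqI, (rule wirtinger_S z nz)+) (simp_all add: field_simps)
  have Eeq: "radial_coeff = (\<lambda>z. 3 / 2 * (complex_of_real (u z))\<^sup>2 + ((b\<^sup>2 - a\<^sup>2) / 2 - a * complex_of_real (u z)))"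
    by (auto simp: radial_coeff_def fun_eq_iff)
  have dE: "has_wirtinger radial_coeff ((3 * complex_of_real (u z) - a) * g z)
      ((3 * complex_of_real (u z) - a) * cnj (g z)) z"
    unfolding Eeq by (rule has_wirtinger_eqI, (rule wirtinger_S z)+) (simp_all add: algebra_simps)
  show ?thesis unfolding pohozaev_def[abs_def]
    apply (rule has_wirtinger_eqI, (rule wirtinger_S dV dE z | simp add: nz)+)
    subgoal using nz by (simp add: pohozaev_z_def divide_simps power2_eq_square power3_eq_cube power4_eq_xxxx algebra_simps)
    subgoal using nz by (simp add: pohozaev_zbar_def divide_simps power2_eq_square power3_eq_cube power4_eq_xxxx algebra_simps)
    done
qed

text \<open>As \<open>4 / conf\<^sup>2\<close> is the density of the hyperbolic area, this says that \<open>V (P - b\<^sup>2 + a\<^sup>2)\<close> is a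
hyperbolic divergence: \<open>Re (pohozaev_z z)\<close> is half of the Euclidean divergence of \<open>pohozaev\<close>.\<close>

lemma divergence_pohozaev:
  assumes z: "z \<in> S"
  shows "Re (pohozaev_z z) = 2 * (2 / (1 - (norm z)\<^sup>2) - 1) / (1 - (norm z)\<^sup>2)\<^sup>2 * (P_fun z - (b\<^sup>2 - a\<^sup>2))"
proof -
  let ?r = "2 * (2 / (1 - (norm z)\<^sup>2) - 1) / (1 - (norm z)\<^sup>2)\<^sup>2 * (P_fun z - (b\<^sup>2 - a\<^sup>2))"
  have nz: "conf z \<noteq> 0" using conf_S z by blast
  have zz: "z * cnj z = 1 - conf z" by (simp add: conf_def)
  have eqP: "complex_of_real (P_fun z) = (conf z)\<^sup>2 * (g z * cnj (g z)) - (complex_of_real (u z))\<^sup>2"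
    unfolding P_fun_def conf_of_real of_real_diff of_real_mult of_real_power of_real_1
    by (simp only: complex_norm_square[symmetric] of_real_power)
  have "complex_of_real ?r = 2 * cosh_origin z / (conf z)\<^sup>2 * (complex_of_real (P_fun z) - (b\<^sup>2 - a\<^sup>2))"
    unfolding cosh_origin_def conf_of_real by simp
  note r = this[unfolded eqP]
  have "pohozaev_z z + cnj (pohozaev_z z) = 2 * complex_of_real ?r"
    unfolding r using nz zz
    apply (simp add: pohozaev_z_def radial_coeff_def cosh_origin_def divide_simps power2_eq_square power3_eq_cube)
    by algebra
  then have "complex_of_real (2 * Re (pohozaev_z z)) = complex_of_real (2 * ?r)"
    unfolding complex_add_cnj by simp
  then show ?thesis by (simp only: of_real_eq_iff)
qed

lemma gradient_component_pohozaev: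
  assumes z: "z \<in> S"
  shows "Re (g z * pohozaev z) = 2 * (2 / (1 - (norm z)\<^sup>2) - 1) * (u z - a) * (norm (g z))\<^sup>2
     + Re (z * g z) * (2 * (norm (g z))\<^sup>2 - 4 * Re (radial_coeff z) / (1 - (norm z)\<^sup>2)\<^sup>2)"
proof -
  let ?t = "1 - (norm z)\<^sup>2"
  have "g z * pohozaev z = 2 * cosh_origin z * (complex_of_real (u z) - a) * (g z * cnj (g z))
     + 2 * (cnj z * cnj (g z)) * (g z * cnj (g z)) - (z * g z) * (4 * radial_coeff z / (conf z)\<^sup>2)"
    by (simp add: pohozaev_def algebra_simps power2_eq_square)
  also have "\<dots> = complex_of_real (2 * (2 / ?t - 1) * (u z - a) * (norm (g z))\<^sup>2)
     + cnj (z * g z) * complex_of_real (2 * (norm (g z))\<^sup>2)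
     - (z * g z) * complex_of_real (4 * Re (radial_coeff z) / ?t\<^sup>2)"
    unfolding complex_norm_square[symmetric] cosh_origin_def conf_of_real radial_coeff_def by simp
  finally have "Re (g z * pohozaev z) = Re (\<dots>)" by (rule arg_cong)
  then show ?thesis by (simp add: algebra_simps)
qed

text \<open>The small multiple \<open>\<delta> cnj g\<close> of the gradient makes up for the fact that \<open>pohozaev\<close> is tangent to
the frontier only in the limit. Its divergence is of order \<open>\<delta>\<close>.\<close>

lemma field_points_out_near_frontier:
  fixes \<delta> :: real
  assumes \<delta>: "\<delta> > 0"
  shows "\<exists>\<mu>>0. \<forall>z\<in>S. a - u z < \<mu> \<longrightarrow> 0 \<le> Re (g z * (pohozaev z + \<delta> * cnj (g z)))"
proof -
  define e where "e z = 2 * (norm (g z))\<^sup>2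
      - 4 * (3 / 2 * (u z)\<^sup>2 + (b\<^sup>2 - a\<^sup>2) / 2 - a * u z) / (1 - (norm z)\<^sup>2)\<^sup>2" for z
  define G where "G z = norm (g z) * (\<delta> - 2 * (2 / (1 - (norm z)\<^sup>2) - 1) * (a - u z)) - \<bar>e z\<bar>" for z
  have contG: "continuous_on (closure S) G"
    unfolding G_def e_def
    by (intro continuous_intros u_closure g_closure) (use conf_closure in force)+
  \<comment> \<open>On the frontier \<open>e = 0\<close> and \<open>g \<noteq> 0\<close>, the latter because of \<open>b \<noteq> 0\<close>.\<close>
  have frontG: "G z > 0" if z: "z \<in> frontier S" for z
  proof -
    have t: "1 - (norm z)\<^sup>2 > 0" using z by (intro conf_closure) (simp add: frontier_def)
    have "(norm (g z))\<^sup>2 = b\<^sup>2 / (1 - (norm z)\<^sup>2)\<^sup>2"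
      using g_frontier[OF z] t by (simp add: field_simps)
    then have "e z = 0"
      by (simp add: e_def u_frontier[OF z] power2_eq_square add_divide_distrib diff_divide_distrib
          algebra_simps)
    moreover have "norm (g z) > 0" using g_frontier[OF z] b_nonzero by auto
    ultimately show ?thesis using \<delta> by (simp add: G_def u_frontier[OF z])
  qed
  have G: "\<exists>\<mu>>0. \<forall>z\<in>S. a - u z < \<mu> \<longrightarrow> 0 < G z"
  proof -
    define K where "K = {z \<in> closure S. G z \<le> 0}"
    have "compact K"
    proof -
      have "closed K" unfolding K_def
        by (intro continuous_closed_preimage_constant continuous_on_closed_Collect_le
            continuous_intros contG) simp
      then show ?thesis
        using compact_Int_closed[OF compact_closure_S, of K] by (simp add: K_def Int_absorb1 subset_eq)
    qed
    have KS: "K \<subseteq> S" unfolding K_def using closure_cases frontG by force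
    show ?thesis
    proof (cases "K = {}")
      case True
      then show ?thesis using closure_subset by (intro exI[of _ 1]) (force simp: K_def)
    next
      case False
      obtain m where m: "m \<in> K" "\<And>w. w \<in> K \<Longrightarrow> u w \<le> u m"
        using continuous_attains_sup[OF \<open>compact K\<close> False continuous_on_subset[OF cont_u KS]] by blast
      have "a - u m > 0" using u_less[OF a_pos] m(1) KS by auto
      moreover have "0 < G z" if "z \<in> S" "a - u z < a - u m" for z
        using m(2)[of z] that closure_subset by (force simp: K_def)
      ultimately show ?thesis by blast
    qed
  qed
  have "0 \<le> Re (g z * (pohozaev z + \<delta> * cnj (g z)))" if z: "z \<in> S" and Gz: "0 < G z" for z
  proof -
    have "Re (g z * (pohozaev z + \<delta> * cnj (g z))) = Re (g z * pohozaev z) + \<delta> * (norm (g z))\<^sup>2"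
    proof -
      have "g z * (pohozaev z + \<delta> * cnj (g z)) = g z * pohozaev z + complex_of_real (\<delta> * (norm (g z))\<^sup>2)"
        unfolding of_real_mult complex_norm_square by (simp add: algebra_simps)
      then show ?thesis by simp
    qed
    also have "\<dots> = (norm (g z))\<^sup>2 * (\<delta> - 2 * (2 / (1 - (norm z)\<^sup>2) - 1) * (a - u z))
        + Re (z * g z) * e z"
      unfolding gradient_component_pohozaev[OF z]
      by (simp add: e_def radial_coeff_def algebra_simps add_divide_distrib diff_divide_distrib)
    also have "\<dots> \<ge> (norm (g z))\<^sup>2 * (\<delta> - 2 * (2 / (1 - (norm z)\<^sup>2) - 1) * (a - u z))
        - norm (g z) * \<bar>e z\<bar>"
    proof -
      have "\<bar>Re (z * g z)\<bar> \<le> norm z * norm (g z)" using abs_Re_le_cmod[of "z * g z"] by (simp add: norm_mult)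
      also have "\<dots> \<le> norm (g z)" using norm_S[OF z] by (simp add: mult_left_le_one_le)
      finally have "\<bar>Re (z * g z) * e z\<bar> \<le> norm (g z) * \<bar>e z\<bar>"
        unfolding abs_mult by (intro mult_right_mono) auto
      then show ?thesis by linarith
    qed
    also have "(norm (g z))\<^sup>2 * (\<delta> - 2 * (2 / (1 - (norm z)\<^sup>2) - 1) * (a - u z))
        - norm (g z) * \<bar>e z\<bar> = norm (g z) * G z"
      by (simp add: G_def power2_eq_square algebra_simps)
    finally have "norm (g z) * G z \<le> Re (g z * (pohozaev z + \<delta> * cnj (g z)))" .
    moreover have "0 \<le> norm (g z) * G z" using Gz by simp
    ultimately show ?thesis by (rule order_trans[rotated])
  qed
  then show ?thesis using G by meson
qed

text \<open>Suppose that \<open>P\<close> is smaller than \<open>b\<^sup>2 - a\<^sup>2\<close> at \<open>z0\<close>, and hence on a ball around it. The field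
\<open>\<phi>((a - u)/\<epsilon>) (pohozaev + \<delta> cnj g)\<close> has compact support, so its divergence has integral zero. The
term with \<open>\<phi>'\<close> is nonpositive, the divergence of \<open>pohozaev\<close> contributes at most a fixed
negative amount from the ball, and \<open>\<delta> \<Delta>u\<close> contributes at most a constant times \<open>\<delta>\<close>. For small
\<open>\<delta>\<close> this is a contradiction.\<close>

lemma P_fun_eq:
  assumes z0: "z0 \<in> S"
  shows "P_fun z0 = b\<^sup>2 - a\<^sup>2"
proof (rule ccontr)
  assume "P_fun z0 \<noteq> b\<^sup>2 - a\<^sup>2"
  then have P0: "P_fun z0 < b\<^sup>2 - a\<^sup>2" using P_fun_le[OF z0] by simp
  have weight: "2 * (2 / (1 - (norm z)\<^sup>2) - 1) / (1 - (norm z)\<^sup>2)\<^sup>2 > 0" if "z \<in> S" for z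
    using conf_pos[OF norm_S[OF that]] by (intro divide_pos_pos) (auto simp: field_simps add_pos_nonneg)
  have f_le: "Re (pohozaev_z z) \<le> 0" if "z \<in> S" for z
    unfolding divergence_pohozaev[OF that] using weight[OF that] P_fun_le[OF that] by (intro mult_nonneg_nonpos) simp_all
  have f0: "Re (pohozaev_z z0) < 0"
    unfolding divergence_pohozaev[OF z0] using weight[OF z0] P0 by (intro mult_pos_neg) simp_all
  have cnz: "\<forall>z\<in>S. conf z \<noteq> 0" using conf_S by blast
  have cE: "continuous_on S radial_coeff" and cV: "continuous_on S cosh_origin"
    unfolding radial_coeff_def[abs_def] cosh_origin_def[abs_def]
    by (intro continuous_intros cont_u cont_conf; use cnz in simp)+
  have cZ1: "continuous_on S pohozaev_z"
    unfolding pohozaev_z_def[abs_def]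
    by (intro continuous_intros cont_u cont_g cont_conf cE cV) (use cnz in auto)
  have cZ2: "continuous_on S pohozaev_zbar"
    unfolding pohozaev_zbar_def[abs_def]
    by (intro continuous_intros cont_u cont_g cont_A cont_conf cE cV) (use cnz in auto)
  have cZ: "continuous_on S pohozaev"
    by (rule has_wirtinger_imp_continuous_on[OF d_pohozaev])
  define \<kappa> where "\<kappa> = - Re (pohozaev_z z0) / 2"
  define \<mu>1 where "\<mu>1 = (a - u z0) / 2"
  have \<kappa>: "\<kappa> > 0" using f0 by (simp add: \<kappa>_def)
  have \<mu>1: "\<mu>1 > 0" using u_less[OF a_pos z0] by (simp add: \<mu>1_def)
  obtain r where r: "r > 0" "\<And>z. z \<in> ball z0 r \<Longrightarrow> z \<in> S \<and> Re (pohozaev_z z) < - \<kappa> \<and> \<mu>1 < a - u z"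
  proof -
    have "open (S \<inter> (\<lambda>z. Re (pohozaev_z z)) -` {..< - \<kappa>})" "open (S \<inter> (\<lambda>z. a - u z) -` {\<mu>1<..})"
      by (intro continuous_open_preimage continuous_intros cZ1 cont_u open_S; simp)+
    then have "open ((S \<inter> (\<lambda>z. Re (pohozaev_z z)) -` {..< - \<kappa>}) \<inter> (S \<inter> (\<lambda>z. a - u z) -` {\<mu>1<..}))"
      by blast
    moreover have "z0 \<in> (S \<inter> (\<lambda>z. Re (pohozaev_z z)) -` {..< - \<kappa>}) \<inter> (S \<inter> (\<lambda>z. a - u z) -` {\<mu>1<..})"
      using z0 f0 u_less[OF a_pos z0] by (simp add: \<kappa>_def \<mu>1_def)
    ultimately obtain r where "r > 0"
      "ball z0 r \<subseteq> (S \<inter> (\<lambda>z. Re (pohozaev_z z)) -` {..< - \<kappa>}) \<inter> (S \<inter> (\<lambda>z. a - u z) -` {\<mu>1<..})"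
      by (meson openE)
    then show ?thesis by (intro that[of r]) auto
  qed
  define h where "h z = 2 * u z / (1 - (norm z)\<^sup>2)\<^sup>2" for z
  have h_nonneg: "0 \<le> h z" if "z \<in> S" for z using u_nonneg[OF that] by (simp add: h_def)
  obtain C where C: "C > 0" "\<And>z. z \<in> S \<Longrightarrow> h z \<le> C"
  proof -
    have "compact (h ` closure S)" unfolding h_def
      by (intro compact_continuous_image compact_closure_S continuous_intros u_closure)
         (use conf_closure in force)
    then obtain B where "\<forall>z\<in>closure S. norm (h z) \<le> B"
      using compact_imp_bounded bounded_iff by (metis (no_types, lifting) imageI)
    then have "h z \<le> \<bar>B\<bar> + 1" if "z \<in> S" for z using that closure_subset by force
    then show ?thesis using that[of "\<bar>B\<bar> + 1"] by simp
  qed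
  define m0 where "m0 = measure lborel (ball z0 r)"
  define m1 where "m1 = measure lborel (ball (0::complex) 1)"
  have m: "m0 > 0" "m1 > 0" using r(1) by (simp_all add: m0_def m1_def content_ball_pos)
  \<comment> \<open>With this \<open>\<delta>\<close> the error \<open>\<delta> C m1\<close> is half of the gain \<open>\<kappa> m0\<close>.\<close>
  define \<delta> where "\<delta> = \<kappa> * m0 / (2 * C * m1)"
  have \<delta>: "\<delta> > 0" using \<kappa> m C(1) by (simp add: \<delta>_def)
  obtain \<mu>2 where \<mu>2: "\<mu>2 > 0"
      "\<And>z. z \<in> S \<Longrightarrow> a - u z < \<mu>2 \<Longrightarrow> 0 \<le> Re (g z * (pohozaev z + \<delta> * cnj (g z)))"
    using field_points_out_near_frontier[OF \<delta>] by blast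
  define \<epsilon> where "\<epsilon> = min \<mu>1 \<mu>2 / 2"
  have \<epsilon>: "\<epsilon> > 0" "2 * \<epsilon> \<le> \<mu>1" "2 * \<epsilon> \<le> \<mu>2" using \<mu>1 \<mu>2(1) by (simp_all add: \<epsilon>_def)
  obtain \<phi> \<phi>' :: "real \<Rightarrow> real" where \<phi>: "\<And>s. DERIV \<phi> s :> \<phi>' s" "continuous_on UNIV \<phi>'"
      "\<And>s. 0 \<le> \<phi>' s" "\<And>s. 0 \<le> \<phi> s" "\<And>s. \<phi> s \<le> 1"
      "\<And>s. s \<le> 1 \<Longrightarrow> \<phi> s = 0" "\<And>s. s \<le> 1 \<Longrightarrow> \<phi>' s = 0"
      "\<And>s. s \<ge> 2 \<Longrightarrow> \<phi> s = 1" "\<And>s. s \<ge> 2 \<Longrightarrow> \<phi>' s = 0"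
    using smooth_step_exists by metis
  define s where "s z = (a - u z) / \<epsilon>" for z
  define W where "W z = pohozaev z + \<delta> * cnj (g z)" for z
  define D1 where "D1 z = complex_of_real (\<phi> (s z)) * (pohozaev_z z + \<delta> * h z)
      + complex_of_real (- \<phi>' (s z) / \<epsilon>) * g z * W z" for z
  define D2 where "D2 z = complex_of_real (\<phi> (s z)) * (pohozaev_zbar z + \<delta> * cnj (A z))
      + complex_of_real (- \<phi>' (s z) / \<epsilon>) * cnj (g z) * W z" for z
  define F where "F z = complex_of_real (\<phi> (s z)) * W z" for z
  have dF: "has_wirtinger F (D1 z) (D2 z) z" if z: "z \<in> S" for z
  proof -
    have "DERIV (\<lambda>x. (a - x) / \<epsilon>) (u z) :> - 1 / \<epsilon>"
      using \<epsilon>(1) by (auto intro!: derivative_eq_intros)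
    from DERIV_chain2[OF \<phi>(1) this]
    have "DERIV (\<lambda>x. \<phi> ((a - x) / \<epsilon>)) (u z) :> - \<phi>' (s z) / \<epsilon>" by (simp add: s_def)
    note cutoff = has_wirtinger_of_real_comp[OF du[OF z] this, folded s_def]
    have dW: "has_wirtinger W (pohozaev_z z + \<delta> * h z) (pohozaev_zbar z + \<delta> * cnj (A z)) z"
      unfolding W_def[abs_def]
      by (rule has_wirtinger_eqI, (rule wirtinger_S d_pohozaev z)+) (simp_all add: laplacian_u h_def)
    show ?thesis unfolding F_def[abs_def] D1_def D2_def
      by (rule has_wirtinger_eqI[OF has_wirtinger_mult[OF cutoff dW]]) (simp_all add: mult_ac)
  qed
  have cs: "continuous_on S s" unfolding s_def by (intro continuous_intros cont_u) (use \<epsilon> in auto)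
  have c\<phi>: "continuous_on UNIV \<phi>"
    using \<phi>(1) by (intro continuous_at_imp_continuous_on ballI DERIV_isCont)
  have ch: "continuous_on S h"
    unfolding h_def by (intro continuous_intros cont_u) (use conf_pos norm_S in force)
  have cW: "continuous_on S W" unfolding W_def by (intro continuous_intros cZ cont_g)
  have cD: "continuous_on S D1" "continuous_on S D2"
    unfolding D1_def D2_def
    by (intro continuous_intros continuous_on_compose2[OF c\<phi> cs] continuous_on_compose2[OF \<phi>(2) cs]
        cW cZ1 cZ2 ch cont_A cont_g; use \<epsilon> in simp)+
  define K where "K = {z \<in> closure S. u z \<le> a - \<epsilon>}"
  have K: "compact K"
  proof -
    have "closed K" unfolding K_def
      by (intro continuous_on_closed_Collect_le continuous_intros u_closure) simp
    then show ?thesis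
      using compact_Int_closed[OF compact_closure_S, of K] by (simp add: K_def Int_absorb1 subset_eq)
  qed
  have KS: "K \<subseteq> S" unfolding K_def using closure_cases u_frontier \<epsilon>(1) by force
  have supp: "F z = 0 \<and> D1 z = 0 \<and> D2 z = 0" if "z \<in> S - K" for z
  proof -
    have "s z \<le> 1" using that closure_subset \<epsilon>(1) by (force simp: K_def s_def)
    then show ?thesis by (simp add: F_def D1_def D2_def \<phi>(6,7))
  qed
  note int = integral_derivative_compact_support_on[OF open_S K KS dF cD supp]
  define R where "R z = Re (if z \<in> S then D1 z else 0)" for z
  have R: "integrable lborel R" "(\<integral>z. R z \<partial>lborel) = 0"
    unfolding R_def using int by (simp_all add: integrable_Re integral_Re)
  have R_le: "R z \<le> \<delta> * C * indicator (ball 0 1) z - \<kappa> * indicator (ball z0 r) z" for z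
  proof (cases "z \<in> S")
    case z: True
    have "R z = \<phi> (s z) * (Re (pohozaev_z z) + \<delta> * h z) - \<phi>' (s z) / \<epsilon> * Re (g z * W z)"
    proof -
      have "D1 z = complex_of_real (\<phi> (s z)) * (pohozaev_z z + complex_of_real (\<delta> * h z))
        - complex_of_real (\<phi>' (s z) / \<epsilon>) * (g z * W z)"
        by (simp add: D1_def)
      then show ?thesis using z by (simp add: R_def)
    qed
    moreover have "0 \<le> \<phi>' (s z) / \<epsilon> * Re (g z * W z)"
    proof (cases "s z < 2")
      case True
      then have "a - u z < \<mu>2" using \<epsilon> by (simp add: s_def field_simps)
      then show ?thesis using \<mu>2(2)[OF z] \<phi>(3) \<epsilon>(1) by (simp add: W_def)
    qed (simp add: \<phi>(9))
    ultimately have Rz: "R z \<le> \<phi> (s z) * Re (pohozaev_z z) + \<phi> (s z) * (\<delta> * h z)"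
      by (simp add: distrib_left)
    have "\<phi> (s z) * (\<delta> * h z) \<le> 1 * (\<delta> * C)"
      using \<phi>(4,5) \<delta> C h_nonneg[OF z] z by (intro mult_mono) auto
    moreover have "\<phi> (s z) * Re (pohozaev_z z) \<le> - \<kappa> * indicator (ball z0 r) z"
    proof (cases "z \<in> ball z0 r")
      case True
      then have "s z \<ge> 2" using r(2)[OF True] \<epsilon> by (simp add: s_def field_simps)
      then show ?thesis using r(2)[OF True] True by (simp add: \<phi>(8))
    next
      case False
      then show ?thesis using f_le[OF z] \<phi>(4) by (simp add: mult_nonneg_nonpos)
    qed
    moreover have "z \<in> ball 0 1" using norm_S[OF z] by simp
    ultimately show ?thesis using Rz by simp
  next
    case False
    then have "z \<notin> ball z0 r" using r(2) by blast
    then show ?thesis using False \<delta> C by (simp add: R_def)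
  qed
  have ib: "integrable lborel (\<lambda>z. x * indicator (ball y d) z)" for x d :: real and y :: complex
    using emeasure_bounded_finite[OF bounded_ball] by (intro integrable_mult_right integrable_real_indicator) auto
  have "(\<integral>z. R z \<partial>lborel) \<le> (\<integral>z. \<delta> * C * indicator (ball 0 1) z - \<kappa> * indicator (ball z0 r) z \<partial>lborel)"
    by (intro integral_mono R(1) Bochner_Integration.integrable_diff ib R_le)
  also have "\<dots> = \<delta> * C * m1 - \<kappa> * m0"
    by (subst Bochner_Integration.integral_diff[OF ib ib]) (simp add: m0_def m1_def)
  also have "\<dots> = - (\<kappa> * m0) / 2" using C(1) m by (simp add: \<delta>_def field_simps)
  finally have "\<kappa> * m0 \<le> 0" using R(2) by simp
  then show False using mult_pos_pos[OF \<kappa> m(1)] by simp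
qed

lemma hopf_zero:
  assumes z: "z \<in> S"
  shows "hopf z = 0"
proof -
  have "has_wirtinger (\<lambda>z. complex_of_real (P_fun z)) 0 0 w" if w: "w \<in> S" for w
    by (rule has_wirtinger_transform_open[OF has_wirtinger_const[of "complex_of_real (b\<^sup>2 - a\<^sup>2)"] open_S w])
       (simp only: P_fun_eq)
  then have "(conf w)\<^sup>2 * hopf w * cnj (g w) = 0" if "w \<in> S" for w
    using has_wirtinger_unique(1) d_P_fun that by blast
  then have "has_wirtinger (\<lambda>z. (conf z)\<^sup>2 * hopf z * cnj (g z)) 0 0 z"
    by (intro has_wirtinger_transform_open[OF has_wirtinger_const[of 0] open_S z]) simp
  moreover obtain l where "has_wirtinger (\<lambda>z. (conf z)\<^sup>2 * hopf z * cnj (g z)) l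
      (complex_of_real ((1 - (norm z)\<^sup>2)\<^sup>2 * (norm (hopf z))\<^sup>2)) z"
    using laplacian_P_fun[OF z] by blast
  ultimately have "complex_of_real ((1 - (norm z)\<^sup>2)\<^sup>2 * (norm (hopf z))\<^sup>2) = 0"
    using has_wirtinger_unique(2) by metis
  then have "(1 - (norm z)\<^sup>2)\<^sup>2 * (norm (hopf z))\<^sup>2 = 0" by (simp only: of_real_eq_0_iff)
  then show ?thesis using conf_pos[OF norm_S[OF z]] by simp
qed

end

section \<open>Hyperbolic disks\<close>

lemma hyp_dist_nonneg:
  assumes "norm m < 1" "norm z < 1"
  shows "0 \<le> hyp_dist m z"
  unfolding hyp_dist_def using conf_pos[OF assms(1)] conf_pos[OF assms(2)]
  by (intro arcosh_nonneg_real) auto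

lemma hyp_disk_eq_cosh:
  assumes m: "norm m < 1" and R: "R \<ge> 0"
  shows "hyp_disk m R = {z \<in> ball 0 1. cosh (hyp_dist m z) < cosh R}"
  unfolding hyp_disk_def using hyp_dist_nonneg[OF m] R
  by (auto simp: cosh_real_nonneg_less_iff)

text \<open>Completing the square exhibits a hyperbolic disk as the intersection of the unit disk with a
Euclidean ball, which is convex.\<close>

lemma connected_hyp_disk:
  assumes m: "norm m < 1" and R: "R \<ge> 0"
  shows "connected (hyp_disk m R)"
proof -
  \<comment> \<open>With these constants the inequality \<open>2 |m - z|\<^sup>2 < s (1 - |z|\<^sup>2)\<close> reads
    \<open>k |p - z|\<^sup>2 < k C\<close>.\<close>
  define s where "s = (cosh R - 1) * (1 - (norm m)\<^sup>2)"
  define k where "k = 2 + s"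
  define p where "p = (2 / k) *\<^sub>R m"
  define C where "C = (s - 2 * (norm m)\<^sup>2) / k + (norm p)\<^sup>2"
  have s: "s \<ge> 0" using conf_pos[OF m] cosh_real_ge_1[of R] by (simp add: s_def)
  then have k: "k > 0" by (simp add: k_def)
  have "cosh (hyp_dist m z) < cosh R \<longleftrightarrow> z \<in> ball p (sqrt C)" if z: "norm z < 1" for z
  proof -
    have "cosh (hyp_dist m z) < cosh R \<longleftrightarrow>
        2 * (norm (m - z))\<^sup>2 / ((1 - (norm m)\<^sup>2) * (1 - (norm z)\<^sup>2)) < cosh R - 1"
      unfolding cosh_hyp_dist[OF m z] by linarith
    also have "\<dots> \<longleftrightarrow> 2 * (norm (m - z))\<^sup>2 < s * (1 - (norm z)\<^sup>2)"
      using conf_pos[OF m] conf_pos[OF z] by (subst pos_divide_less_eq) (simp_all add: s_def mult_ac)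
    also have "\<dots> \<longleftrightarrow> k * (norm (p - z))\<^sup>2 < k * C"
    proof -
      have "k * (norm (p - z))\<^sup>2 = k * (norm p)\<^sup>2 - 2 * (k * (p \<bullet> z)) + k * (norm z)\<^sup>2"
        by (simp add: power2_norm_eq_inner algebra_simps inner_commute)
      also have "k * (p \<bullet> z) = 2 * (m \<bullet> z)" using k by (simp add: p_def)
      finally have 1: "k * (norm (p - z))\<^sup>2 = k * (norm p)\<^sup>2 - 4 * (m \<bullet> z) + k * (norm z)\<^sup>2" by simp
      have 2: "k * C = s - 2 * (norm m)\<^sup>2 + k * (norm p)\<^sup>2"
        using k by (simp add: C_def distrib_left)
      have 3: "(norm (m - z))\<^sup>2 = (norm m)\<^sup>2 - 2 * (m \<bullet> z) + (norm z)\<^sup>2"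
        by (simp add: power2_norm_eq_inner algebra_simps inner_commute)
      have 4: "k * (norm z)\<^sup>2 = 2 * (norm z)\<^sup>2 + s * (norm z)\<^sup>2" by (simp add: k_def distrib_right)
      show ?thesis unfolding 1 2 3 4 by (simp add: right_diff_distrib) linarith
    qed
    also have "\<dots> \<longleftrightarrow> (norm (p - z))\<^sup>2 < C" using k by simp
    also have "\<dots> \<longleftrightarrow> norm (p - z) < sqrt C"
      using real_sqrt_less_iff[of "(norm (p - z))\<^sup>2" C] by simp
    finally show ?thesis by (simp add: dist_norm)
  qed
  then have "hyp_disk m R = ball 0 1 \<inter> ball p (sqrt C)"
    unfolding hyp_disk_eq_cosh[OF m R] by auto
  then show ?thesis by (simp add: convex_connected convex_Int)
qed

text \<open>The inequality \<open>2 |c - z|\<^sup>2 \<le> L (1 - |z|\<^sup>2)\<close> is a closed condition and cannot hold on the unit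
circle, where it would force \<open>z = c\<close>.\<close>

lemma hyp_bounded_closure:
  assumes "S \<subseteq> ball 0 1" "hyp_bounded S"
  shows "closure S \<subseteq> ball 0 1"
proof -
  obtain c R where c: "norm c < 1" "S \<subseteq> hyp_disk c R"
    using assms(2) by (auto simp: hyp_bounded_def)
  define L where "L = (cosh R - 1) * (1 - (norm c)\<^sup>2)"
  define T where "T = {z. norm z \<le> 1 \<and> 2 * (norm (c - z))\<^sup>2 \<le> L * (1 - (norm z)\<^sup>2)}"
  have "S \<subseteq> T"
  proof
    fix z assume "z \<in> S"
    then have z: "norm z < 1" "hyp_dist c z < R" using c(2) by (auto simp: hyp_disk_def)
    have "cosh (hyp_dist c z) < cosh R"
      using hyp_dist_nonneg[OF c(1) z(1)] z(2) by (subst cosh_real_nonneg_less_iff) auto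
    then have "2 * (norm (c - z))\<^sup>2 / ((1 - (norm c)\<^sup>2) * (1 - (norm z)\<^sup>2)) < cosh R - 1"
      unfolding cosh_hyp_dist[OF c(1) z(1)] by linarith
    then have "2 * (norm (c - z))\<^sup>2 < L * (1 - (norm z)\<^sup>2)"
      using conf_pos[OF c(1)] conf_pos[OF z(1)]
      by (subst (asm) pos_divide_less_eq) (simp_all add: L_def mult_ac)
    then show "z \<in> T" using z by (simp add: T_def)
  qed
  moreover have "closed T"
    unfolding T_def by (intro closed_Collect_conj closed_Collect_le continuous_intros)
  ultimately have "closure S \<subseteq> T" by (rule closure_minimal)
  moreover have "norm z \<noteq> 1" if "z \<in> T" for z
  proof
    assume "norm z = 1"
    then have "(norm (c - z))\<^sup>2 \<le> 0" using that by (simp add: T_def)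
    then have "c = z" by simp
    then show False using c(1) \<open>norm z = 1\<close> by simp
  qed
  ultimately show ?thesis by (force simp: T_def)
qed

context hyperbolic_overdetermined
begin

lemma solution_is_radial:
  assumes conn: "connected S" and ab: "a\<^sup>2 \<noteq> b\<^sup>2"
  shows "\<exists>c R B. c \<in> ball 0 1 \<and> R > 0 \<and> S = hyp_disk c R \<and>
    (\<forall>z\<in>closure S. u z = B * cosh (hyp_dist c z)) \<and> a\<^sup>2 - b\<^sup>2 = B\<^sup>2 \<and> B\<^sup>2 > 0"
proof -
  obtain m where m: "m \<in> closure S" "\<And>w. w \<in> closure S \<Longrightarrow> u m \<le> u w"
    using continuous_attains_inf[OF compact_closure_S _ u_closure] nonempty by auto
  obtain z1 where z1: "z1 \<in> S" using nonempty by auto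
  have "u m < a" using m(2)[of z1] z1 closure_subset u_less[OF a_pos z1] by force
  then have mS: "m \<in> S" using closure_cases m(1) u_frontier by force
  have gm: "g m = 0"
  proof -
    have "((\<lambda>z. Re (complex_of_real (u z))) has_derivative (\<lambda>h. Re (g m * h + cnj (g m) * cnj h))) (at m)"
      using du[OF mS] unfolding has_wirtinger_def by (rule has_derivative_Re)
    then have "(u has_derivative (\<lambda>h. 2 * Re (g m * h))) (at m)" by (simp add: mult.commute)
    from differential_zero_maxmin[OF mS open_S this]
    have "(\<lambda>h. 2 * Re (g m * h)) = (\<lambda>h. 0)" using m(2) closure_subset by blast
    from fun_cong[OF this, of "cnj (g m)"] have "2 * Re (g m * cnj (g m)) = 0" .
    then show ?thesis unfolding complex_norm_square[symmetric] by simp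
  qed
  define B where "B = u m"
  have "- (u m)\<^sup>2 = b\<^sup>2 - a\<^sup>2" using P_fun_eq[OF mS] by (simp add: P_fun_def gm)
  then have B2: "a\<^sup>2 - b\<^sup>2 = B\<^sup>2" by (simp add: B_def)
  have B: "B > 0" using u_nonneg[OF mS] B2 ab by (cases "B = 0") (auto simp: B_def)
  have m1: "norm m < 1" using norm_S[OF mS] .
  have radial: "u z = B * cosh (hyp_dist m z)" if z: "z \<in> closure S" for z
  proof -
    have lt: "norm w < 1" if "w \<in> closure S" for w using that closure_disk by auto
    have "continuous_on (closure S) (\<lambda>w. cosh (hyp_dist m w))"
    proof (rule continuous_on_eq)
      show "continuous_on (closure S) (\<lambda>w. 1 + 2 * (norm (m - w))\<^sup>2 / ((1 - (norm m)\<^sup>2) * (1 - (norm w)\<^sup>2)))"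
        using conf_pos[OF m1] conf_closure by (intro continuous_intros) force
    qed (simp add: cosh_hyp_dist[OF m1 lt])
    then have "continuous_on (closure S) (\<lambda>w. u w - B * cosh (hyp_dist m w))"
      by (intro continuous_on_diff u_closure continuous_on_mult_left)
    from continuous_constant_on_closure[OF this _ z, of 0] show ?thesis
      using radial_of_hopf_zero[OF conn hopf_zero mS gm] by (simp add: B_def)
  qed
  define R where "R = arcosh (a / B)"
  have aB: "a / B > 1" using \<open>u m < a\<close> B by (simp add: B_def)
  have R: "R > 0" "cosh R = a / B"
    unfolding R_def using aB arcosh_real_gt_1_iff[of "a / B"] cosh_arcosh_real[of "a / B"] by linarith+
  have disk: "hyp_disk m R = {z \<in> ball 0 1. B * cosh (hyp_dist m z) < a}"
    unfolding hyp_disk_eq_cosh[OF m1 less_imp_le[OF R(1)]] R(2) using B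
    by (auto simp: field_simps)
  have sub: "S \<subseteq> hyp_disk m R"
    unfolding disk using u_less[OF a_pos] radial closure_subset S_disk by force
  have "hyp_disk m R \<inter> frontier S = {}"
    unfolding disk using radial u_frontier by (force simp: frontier_def)
  then have "S = hyp_disk m R"
    using connected_Int_frontier[OF connected_hyp_disk[OF m1 less_imp_le[OF R(1)]], of S] sub mS by blast
  then show ?thesis using m1 R(1) radial B2 B by (intro exI[of _ m] exI[of _ R] exI[of _ B]) auto
qed

end

section \<open>The gradient on the boundary\<close>

text \<open>L'Hospital's rule, with the continuous extension \<open>f'\<close> of the differential to the closure.\<close>

lemma derivative_along_segment:
  fixes f :: "complex \<Rightarrow> real" and f' :: "complex \<Rightarrow> complex \<Rightarrow>\<^sub>L real"
  assumes cont: "continuous_on (closure S) f" "continuous_on (closure S) f'"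
    and deriv: "\<And>z. z \<in> S \<Longrightarrow> (f has_derivative blinfun_apply (f' z)) (at z)"
    and p: "p \<in> closure S"
    and seg: "\<forall>\<^sub>F t in at_right 0. p + t *\<^sub>R v \<in> S"
  shows "((\<lambda>t. (f (p + t *\<^sub>R v) - f p) / t) \<longlongrightarrow> f' p v) (at_right 0)"
proof (rule lhopital_right_0[where f' = "\<lambda>t. f' (p + t *\<^sub>R v) v" and g' = "\<lambda>t. 1"])
  have cl: "\<forall>\<^sub>F t in at_right 0. p + t *\<^sub>R v \<in> closure S"
    using seg by (rule eventually_mono) (use closure_subset in blast)
  have lim: "((\<lambda>t. p + t *\<^sub>R v) \<longlongrightarrow> p) (at_right 0)"
    by (rule tendsto_eq_intros refl | simp)+
  show "((\<lambda>t. f (p + t *\<^sub>R v) - f p) \<longlongrightarrow> 0) (at_right 0)"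
    using continuous_on_tendsto_compose[OF cont(1) lim p cl] by (rule LIM_zero)
  show "((\<lambda>t. f' (p + t *\<^sub>R v) v / 1) \<longlongrightarrow> f' p v) (at_right 0)"
    using bounded_bilinear.tendsto[OF bounded_bilinear_blinfun_apply
        continuous_on_tendsto_compose[OF cont(2) lim p cl] tendsto_const]
    by simp
  show "\<forall>\<^sub>F t in at_right 0. DERIV (\<lambda>t. f (p + t *\<^sub>R v) - f p) t :> f' (p + t *\<^sub>R v) v"
    using seg
  proof (rule eventually_mono)
    fix t assume "p + t *\<^sub>R v \<in> S"
    from has_real_derivative_line[OF deriv[OF this]]
    show "DERIV (\<lambda>t. f (p + t *\<^sub>R v) - f p) t :> f' (p + t *\<^sub>R v) v"
      by (auto intro!: derivative_eq_intros)
  qed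
  show "\<forall>\<^sub>F t::real in at_right 0. t \<noteq> 0" by (auto simp: eventually_at_filter)
qed (auto intro: tendsto_ident_at)

text \<open>The coefficient of \<open>dz\<close> in a real linear form.\<close>

definition wirtinger_gradient :: "complex \<Rightarrow>\<^sub>L real \<Rightarrow> complex" where
  "wirtinger_gradient D = (complex_of_real (D 1) - \<i> * complex_of_real (D \<i>)) / 2"

lemma blinfun_apply_complex:
  fixes D :: "complex \<Rightarrow>\<^sub>L 'b::real_normed_vector"
  shows "D h = Re h *\<^sub>R D 1 + Im h *\<^sub>R D \<i>"
proof -
  have "h = Re h *\<^sub>R 1 + Im h *\<^sub>R \<i>" by (simp add: complex_eq_iff)
  then show ?thesis by (metis blinfun.add_right blinfun.scaleR_right)
qed

lemma blinfun_apply_wirtinger_gradient: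
  "blinfun_apply D h = 2 * Re (wirtinger_gradient D * h)"
  by (subst blinfun_apply_complex) (simp add: wirtinger_gradient_def algebra_simps)

lemma continuous_on_wirtinger_gradient:
  fixes D :: "'a::topological_space \<Rightarrow> complex \<Rightarrow>\<^sub>L real"
  assumes "continuous_on X D"
  shows "continuous_on X (\<lambda>z. wirtinger_gradient (D z))"
  unfolding wirtinger_gradient_def by (intro continuous_intros assms) simp

lemma has_derivative_minus_blinfun:
  fixes f :: "complex \<Rightarrow> 'b::real_normed_vector"
  assumes "(f has_derivative blinfun_apply D) (at z)"
  shows "((\<lambda>z. - f z) has_derivative blinfun_apply (- D)) (at z)"
proof -
  have "blinfun_apply (- D) = (\<lambda>h. - blinfun_apply D h)"
    by (rule ext) (rule blinfun.minus_left)
  then show ?thesis using has_derivative_minus[OF assms] by simp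
qed

lemma dir_deriv_dir_deriv:
  fixes u :: "complex \<Rightarrow> real" and u' :: "complex \<Rightarrow> complex \<Rightarrow>\<^sub>L real"
  assumes S: "open S" "z \<in> S"
    and u': "\<And>z. z \<in> S \<Longrightarrow> (u has_derivative blinfun_apply (u' z)) (at z)"
    and u'': "(u' has_derivative blinfun_apply D) (at z)"
  shows "dir_deriv (dir_deriv u e) d z = D d e"
proof -
  have "dir_deriv (dir_deriv u e) d z = dir_deriv (\<lambda>w. u' w e) d z"
    by (rule dir_deriv_cong[OF S]) (rule dir_derivI[OF u'])
  also have "\<dots> = D d e"
    by (rule dir_derivI[OF bounded_linear.has_derivative[OF blinfun.bounded_linear_left u'']])
  finally show ?thesis .
qed

text \<open>By symmetry of the second derivative the mixed Wirtinger derivative of \<open>u\<close> is a quarter of the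
Euclidean Laplacian, to which the hyperbolic one is proportional.\<close>

lemma hyperbolic_solution_of_C2:
  fixes u :: "complex \<Rightarrow> real" and u' :: "complex \<Rightarrow> complex \<Rightarrow>\<^sub>L real"
    and u'' :: "complex \<Rightarrow> complex \<Rightarrow>\<^sub>L complex \<Rightarrow>\<^sub>L real"
  assumes S: "open S" "S \<subseteq> ball 0 1"
    and u': "\<And>z. z \<in> S \<Longrightarrow> (u has_derivative blinfun_apply (u' z)) (at z)"
    and u'': "\<And>z. z \<in> S \<Longrightarrow> (u' has_derivative blinfun_apply (u'' z)) (at z)"
    and cont: "continuous_on S u''"
    and eq: "\<And>z. z \<in> S \<Longrightarrow> hyp_laplacian u z = 2 * u z"
  shows "hyperbolic_solution S u (\<lambda>z. wirtinger_gradient (u' z))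
    (\<lambda>z. (complex_of_real (u'' z 1 1) - complex_of_real (u'' z \<i> \<i>)
       - 2 * \<i> * complex_of_real (u'' z 1 \<i>)) / 4)"
proof
  show "open S" "S \<subseteq> ball 0 1" by fact+
  fix z assume z: "z \<in> S"
  have dz: "(complex_of_real (u'' z h 1) - \<i> * complex_of_real (u'' z h \<i>)) / 2
      = (complex_of_real (u'' z 1 1) - complex_of_real (u'' z \<i> \<i>)
       - 2 * \<i> * complex_of_real (u'' z 1 \<i>)) / 4 * h
       + 2 * complex_of_real (u z) / (conf z)\<^sup>2 * cnj h" for h
  proof -
    have sym: "u'' z \<i> 1 = u'' z 1 \<i>"
      by (rule second_derivative_symmetric[OF S(1) z u' u'' cont])
    note dd = dir_deriv_dir_deriv[OF S(1) z u' u''[OF z]]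
    have t: "1 - (norm z)\<^sup>2 > 0" using z S(2) by (intro conf_pos) auto
    have "(1 - (norm z)\<^sup>2)\<^sup>2 / 4 * (u'' z 1 1 + u'' z \<i> \<i>) = 2 * u z"
      using eq[OF z] hyp_laplacian_conformal[of z u] z S(2) by (simp add: dd subset_eq)
    then have "2 * u z / (1 - (norm z)\<^sup>2)\<^sup>2 = (u'' z 1 1 + u'' z \<i> \<i>) / 4"
      using t by (simp add: field_simps)
    then have "complex_of_real (2 * u z / (1 - (norm z)\<^sup>2)\<^sup>2)
        = complex_of_real ((u'' z 1 1 + u'' z \<i> \<i>) / 4)" by (rule arg_cong)
    then have lap: "2 * complex_of_real (u z) / (conf z)\<^sup>2
        = (complex_of_real (u'' z 1 1) + complex_of_real (u'' z \<i> \<i>)) / 4"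
      by (simp add: conf_of_real)
    have e: "u'' z h w = Re h * u'' z 1 w + Im h * u'' z \<i> w" for w
      by (subst blinfun_apply_complex[of "u'' z" h]) (simp add: blinfun.add_left blinfun.scaleR_left)
    show ?thesis unfolding lap e[of 1] e[of \<i>] sym by (simp add: complex_eq_iff field_simps)
  qed
  show "has_wirtinger (\<lambda>z. complex_of_real (u z)) (wirtinger_gradient (u' z))
      (cnj (wirtinger_gradient (u' z))) z"
  proof -
    have "complex_of_real (u' z h) = wirtinger_gradient (u' z) * h + cnj (wirtinger_gradient (u' z)) * cnj h" for h
      unfolding blinfun_apply_wirtinger_gradient by (simp add: complex_eq_iff)
    then show ?thesis
      using has_derivative_of_real[OF u'[OF z], where 'a = complex] by (simp add: has_wirtinger_def)
  qed
  show "has_wirtinger (\<lambda>z. wirtinger_gradient (u' z))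
      ((complex_of_real (u'' z 1 1) - complex_of_real (u'' z \<i> \<i>)
       - 2 * \<i> * complex_of_real (u'' z 1 \<i>)) / 4) (2 * complex_of_real (u z) / (conf z)\<^sup>2) z"
  proof -
    have "((\<lambda>z. (complex_of_real (u' z 1) - \<i> * complex_of_real (u' z \<i>)) / 2) has_derivative
        (\<lambda>h. (complex_of_real (u'' z h 1) - \<i> * complex_of_real (u'' z h \<i>)) / 2)) (at z)"
      unfolding divide_inverse
      by (intro has_derivative_mult_left has_derivative_diff has_derivative_of_real
          has_derivative_mult_right bounded_linear.has_derivative[OF blinfun.bounded_linear_left] u'' z)
    then show ?thesis by (simp only: has_wirtinger_def dz wirtinger_gradient_def)
  qed
next
  show "continuous_on S (\<lambda>z. (complex_of_real (u'' z 1 1) - complex_of_real (u'' z \<i> \<i>)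
       - 2 * \<i> * complex_of_real (u'' z 1 \<i>)) / 4)"
    by (intro continuous_intros cont) simp
qed

text \<open>Two consequences of the differentiability of the boundary graph, where \<open>k\<close> is its slope at \<open>p\<close>. The
straight directions above the tangent line point into the domain. The tangent line is spanned by the
velocity of a curve in the frontier, so that the exterior normal is orthogonal to it.\<close>

lemma local_graph_at_frontier:
  assumes S: "open S" and bd: "C2_holder_boundary \<alpha> S" and p: "p \<in> frontier S"
  shows "\<exists>e k. norm e = 1 \<and> boundary_tangent S p (e * Complex 1 k) \<and>
    (\<forall>x y. k * x < y \<longrightarrow> (\<forall>\<^sub>F t in at_right 0. p + t *\<^sub>R (e * Complex x y) \<in> S))"
proof -
  obtain e r \<gamma> where e: "norm e = 1" and r: "r > 0" and C2: "C2_holder_on \<alpha> {-r<..<r} \<gamma>"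
    and graph: "S \<inter> ball p r = {z \<in> ball p r. Im ((z - p) / e) > \<gamma> (Re ((z - p) / e))}"
    using bd p unfolding C2_holder_boundary_def by blast
  obtain \<gamma>' where \<gamma>': "\<And>t. t \<in> {-r<..<r} \<Longrightarrow> DERIV \<gamma> t :> \<gamma>' t"
    using C2 unfolding C2_holder_on_def by blast
  have e0: "e \<noteq> 0" using e by auto
  have in_iff: "p + e * w \<in> S \<longleftrightarrow> \<gamma> (Re w) < Im w" if "norm w < r" for w
  proof -
    have "p + e * w \<in> ball p r" using that e by (simp add: dist_norm norm_mult)
    then have "p + e * w \<in> S \<longleftrightarrow> p + e * w \<in> S \<inter> ball p r" by blast
    also have "\<dots> \<longleftrightarrow> \<gamma> (Re w) < Im w"
      unfolding graph using \<open>p + e * w \<in> ball p r\<close> e0 by simp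
    finally show ?thesis .
  qed
  have cont\<gamma>: "isCont \<gamma> t" if "t \<in> {-r<..<r}" for t using \<gamma>'[OF that] by (rule DERIV_isCont)
  have \<gamma>0: "\<gamma> 0 = 0"
  proof (rule antisym)
    have "p \<notin> S" using p S by (simp add: frontier_def interior_open)
    then show "0 \<le> \<gamma> 0" using in_iff[of 0] r by simp
    show "\<gamma> 0 \<le> 0"
    proof (rule ccontr)
      assume "\<not> \<gamma> 0 \<le> 0"
      have "isCont (\<lambda>w. \<gamma> (Re w) - Im w) 0"
        by (intro continuous_intros isCont_o2[of _ Re \<gamma>]) (use cont\<gamma>[of 0] r in simp_all)
      then have "\<forall>\<^sub>F w in at 0. 0 < \<gamma> (Re w) - Im w"
        using \<open>\<not> \<gamma> 0 \<le> 0\<close> by (intro order_tendstoD(1)[of _ "\<gamma> 0"]) (simp_all add: isCont_def)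
      then obtain d where d: "d > 0" "\<And>w. w \<noteq> 0 \<Longrightarrow> dist w 0 < d \<Longrightarrow> Im w < \<gamma> (Re w)"
        unfolding eventually_at by auto
      have "p \<in> closure S" using p by (simp add: frontier_def)
      then obtain y where y: "y \<in> S" "dist y p < min d r"
        using d(1) r unfolding closure_approachable by (metis min_less_iff_conj)
      define w where "w = (y - p) / e"
      have yw: "y = p + e * w" using e0 by (simp add: w_def)
      have nw: "norm w < min d r" using y(2) e by (simp add: w_def dist_norm norm_divide)
      have "w \<noteq> 0" using y(1) yw \<open>p \<notin> S\<close> by auto
      then have "Im w < \<gamma> (Re w)" using d(2) nw by simp
      then show False using in_iff[of w] y(1) yw nw by simp
    qed
  qed
  have inward: "\<forall>\<^sub>F t in at_right 0. p + t *\<^sub>R (e * Complex x y) \<in> S" if xy: "\<gamma>' 0 * x < y" for x y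
  proof -
    have "DERIV \<gamma> (0 * x) :> \<gamma>' 0" using \<gamma>' r by simp
    moreover have "DERIV (\<lambda>t. t * x) 0 :> x" by (auto intro!: derivative_eq_intros)
    ultimately have "DERIV (\<lambda>t. \<gamma> (t * x)) 0 :> \<gamma>' 0 * x" by (rule DERIV_chain2)
    then have D: "DERIV (\<lambda>t. t * y - \<gamma> (t * x)) 0 :> y - \<gamma>' 0 * x"
      by (auto intro!: derivative_eq_intros)
    obtain d where d: "d > 0" "\<forall>h>0. h < d \<longrightarrow> 0 * y - \<gamma> (0 * x) < (0 + h) * y - \<gamma> ((0 + h) * x)"
      using DERIV_pos_inc_right[OF D] xy by auto
    define d' where "d' = min d (r / (norm (Complex x y) + 1))"
    have "d' > 0" using d(1) r by (simp add: d'_def add_nonneg_pos)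
    moreover have "p + t *\<^sub>R (e * Complex x y) \<in> S" if t: "0 < t" "t < d'" for t
    proof -
      have "t * (norm (Complex x y) + 1) < r"
        using t by (simp add: d'_def pos_less_divide_eq add_nonneg_pos)
      then have "norm (t *\<^sub>R Complex x y) < r" using t by (simp add: distrib_left)
      moreover have "\<gamma> (t * x) < t * y" using d(2) t \<gamma>0 by (simp add: d'_def)
      ultimately have "p + e * (t *\<^sub>R Complex x y) \<in> S" by (subst in_iff) simp_all
      then show ?thesis by simp
    qed
    ultimately show ?thesis unfolding eventually_at_right_field by blast
  qed
  have "boundary_tangent S p (e * Complex 1 (\<gamma>' 0))"
  proof -
    define w where "w t = Complex t (\<gamma> t)" for t
    have dw: "(w has_vector_derivative Complex 1 (\<gamma>' 0)) (at 0)"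
    proof -
      have "DERIV \<gamma> 0 :> \<gamma>' 0" using \<gamma>' r by simp
      then show ?thesis unfolding w_def
        by (intro has_vector_derivative_complex_iff[THEN iffD2])
           (simp add: has_real_derivative_iff_has_vector_derivative)
    qed
    have "isCont w 0" using dw has_vector_derivative_continuous by blast
    then have "\<forall>\<^sub>F t in at 0. dist (w t) (w 0) < r" using r by (simp add: isCont_def tendstoD)
    then obtain d where d: "d > 0" "\<And>t. t \<noteq> 0 \<Longrightarrow> dist t 0 < d \<Longrightarrow> dist (w t) (w 0) < r"
      unfolding eventually_at by auto
    have w0: "w 0 = 0" by (simp add: w_def \<gamma>0 complex_eq_iff)
    have nw: "norm (w t) < r" if "\<bar>t\<bar> < d" for t
      using d(2)[of t] that r by (cases "t = 0") (simp_all add: w0)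
    \<comment> \<open>Outside a neighbourhood of 0 the curve rests at \<open>p\<close>, so that it stays in the frontier for
      all times.\<close>
    define c where "c t = (if \<bar>t\<bar> < d then p + e * w t else p)" for t
    have "c t \<in> frontier S" for t
    proof (cases "\<bar>t\<bar> < d")
      case True
      have "p + e * w t \<notin> S" using in_iff[OF nw[OF True]] by (simp add: w_def)
      moreover have "p + e * w t \<in> closure S"
        unfolding closure_approachable
      proof (intro allI impI)
        fix \<epsilon> :: real assume \<epsilon>: "\<epsilon> > 0"
        have "0 < min \<epsilon> (r - norm (w t))" using \<epsilon> nw[OF True] by simp
        then obtain h where "0 < h" "h < min \<epsilon> (r - norm (w t))" using dense by blast
        then have h: "0 < h" "h < \<epsilon>" "norm (w t) + h < r" by simp_all
        have "norm (w t + h *\<^sub>R \<i>) < r" using h norm_triangle_ineq[of "w t" "h *\<^sub>R \<i>"] by simp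
        then have "p + e * (w t + h *\<^sub>R \<i>) \<in> S" using h by (subst in_iff) (simp_all add: w_def)
        moreover have "dist (p + e * (w t + h *\<^sub>R \<i>)) (p + e * w t) < \<epsilon>"
          using h e by (simp add: dist_norm norm_mult distrib_left)
        ultimately show "\<exists>y\<in>S. dist y (p + e * w t) < \<epsilon>" by blast
      qed
      ultimately show ?thesis using True S by (simp add: c_def frontier_def interior_open)
    qed (use p in \<open>simp add: c_def\<close>)
    moreover have "(c has_vector_derivative e * Complex 1 (\<gamma>' 0)) (at 0)"
    proof (rule has_vector_derivative_transform_within_open)
      show "((\<lambda>t. p + e * w t) has_vector_derivative e * Complex 1 (\<gamma>' 0)) (at 0)"
        by (rule has_vector_derivative_eq_rhs[OF has_vector_derivative_add[OF
              has_vector_derivative_const has_vector_derivative_mult_right[OF dw]]]) simp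
    qed (use d in \<open>auto simp: c_def intro: open_greaterThanLessThan[of "-d" d]\<close>)
    moreover have "c 0 = p" using d by (simp add: c_def w0)
    ultimately show ?thesis unfolding boundary_tangent_def by blast
  qed
  then show ?thesis using e inward by blast
qed

text \<open>As \<open>p\<close> is a maximum point of \<open>u\<close>, the differential at \<open>p\<close> is nonpositive on the half plane
of inward directions, and hence vanishes on its boundary line, the tangent line. Therefore the
gradient is a multiple of the normal, and its length is given by the normal derivative.\<close>

lemma overdetermined_gradient_norm:
  fixes u :: "complex \<Rightarrow> real" and u' :: "complex \<Rightarrow> complex \<Rightarrow>\<^sub>L real"
  assumes S: "open S" and bd: "C2_holder_boundary \<alpha> S"
    and p: "p \<in> frontier S" "norm p < 1" and n: "exterior_unit_normal S p n"
    and cont: "continuous_on (closure S) u" "continuous_on (closure S) u'"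
    and deriv: "\<And>z. z \<in> S \<Longrightarrow> (u has_derivative blinfun_apply (u' z)) (at z)"
    and le: "\<And>z. z \<in> S \<Longrightarrow> u z \<le> u p" and b: "has_exterior_derivative u n p b"
  shows "(1 - (norm p)\<^sup>2)\<^sup>2 * (norm (wirtinger_gradient (u' p)))\<^sup>2 = b\<^sup>2"
proof -
  define g where "g = wirtinger_gradient (u' p)"
  have pc: "p \<in> closure S" using p(1) by (simp add: frontier_def)
  obtain e k where e: "norm e = 1" and tangent: "boundary_tangent S p (e * Complex 1 k)"
    and inward: "\<And>x y. k * x < y \<Longrightarrow> \<forall>\<^sub>F t in at_right 0. p + t *\<^sub>R (e * Complex x y) \<in> S"
    using local_graph_at_frontier[OF S bd p(1)] by blast
  have nonpos: "u' p (e * Complex x y) \<le> 0" if "k * x < y" for x y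
  proof (rule tendsto_upperbound)
    show "((\<lambda>t. (u (p + t *\<^sub>R (e * Complex x y)) - u p) / t) \<longlongrightarrow> u' p (e * Complex x y)) (at_right 0)"
      by (rule derivative_along_segment[OF cont deriv pc inward[OF that]])
    have "\<forall>\<^sub>F t::real in at_right 0. 0 < t" by (auto simp: eventually_at_filter)
    then show "\<forall>\<^sub>F t in at_right 0. (u (p + t *\<^sub>R (e * Complex x y)) - u p) / t \<le> 0"
      using inward[OF that] by eventually_elim (use le in \<open>simp add: divide_nonpos_pos\<close>)
  qed simp
  have half: "s * u' p (e * Complex 1 k) \<le> 0" if s: "s = 1 \<or> s = - 1" for s
  proof (rule ccontr)
    assume *: "\<not> s * u' p (e * Complex 1 k) \<le> 0"
    \<comment> \<open>The direction \<open>s (1 + \<i> k) + \<i> x\<close> points inward, and \<open>x\<close> is so small that the differential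
      would still be positive on it.\<close>
    define x where "x = s * u' p (e * Complex 1 k) / (2 * (\<bar>u' p (e * \<i>)\<bar> + 1))"
    have x: "x > 0" using * by (simp add: x_def)
    have "e * Complex s (s * k + x) = s *\<^sub>R (e * Complex 1 k) + x *\<^sub>R (e * \<i>)"
      by (simp add: complex_eq_iff algebra_simps)
    then have "s * u' p (e * Complex 1 k) + x * u' p (e * \<i>) \<le> 0"
      using nonpos[of s "s * k + x"] x by (simp add: blinfun.add_right blinfun.scaleR_right mult.commute)
    moreover have "- (x * u' p (e * \<i>)) \<le> x * (\<bar>u' p (e * \<i>)\<bar> + 1)"
      using x by (simp add: abs_if algebra_simps)
    moreover have "x * (\<bar>u' p (e * \<i>)\<bar> + 1) = s * u' p (e * Complex 1 k) / 2"
      by (simp add: x_def field_simps)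
    ultimately show False using * by linarith
  qed
  then have u'_tangent: "u' p (e * Complex 1 k) = 0" using half[of 1] half[of "- 1"] by simp
  have n_tangent: "n \<bullet> (e * Complex 1 k) = 0"
    using n tangent conf_pos[OF p(2)] unfolding exterior_unit_normal_def hyp_metric_def by fastforce
  have n_norm: "4 * (norm n)\<^sup>2 = (1 - (norm p)\<^sup>2)\<^sup>2"
    using n conf_pos[OF p(2)] unfolding exterior_unit_normal_def hyp_metric_def
    by (simp add: power2_norm_eq_inner[symmetric] field_simps)
  have u'_n: "u' p n = b"
  proof -
    obtain \<epsilon> where "\<epsilon> > 0" "\<forall>t\<in>{0<..<\<epsilon>}. p - t *\<^sub>R n \<in> S"
      using n unfolding exterior_unit_normal_def by blast
    then have "\<forall>\<^sub>F t in at_right 0. p + t *\<^sub>R (- n) \<in> S"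
      unfolding eventually_at_right_field by (intro exI[of _ \<epsilon>]) auto
    from tendsto_minus[OF derivative_along_segment[OF cont deriv pc this]]
    have "((\<lambda>t. (u p - u (p - t *\<^sub>R n)) / t) \<longlongrightarrow> u' p n) (at_right 0)"
      by (simp add: blinfun.minus_right minus_divide_left)
    then show ?thesis
      using b tendsto_unique[OF trivial_limit_at_right_real] unfolding has_exterior_derivative_def by blast
  qed
  define \<tau> where "\<tau> = e * Complex 1 k"
  have \<tau>: "\<tau> \<noteq> 0" using e by (auto simp: \<tau>_def complex_eq_iff[of "Complex 1 k"])
  have 1: "Re (g * \<tau>) = 0"
    using u'_tangent unfolding blinfun_apply_wirtinger_gradient by (simp add: g_def \<tau>_def)
  have 2: "Re (n * cnj \<tau>) = 0" using n_tangent unfolding \<tau>_def[symmetric] by (simp add: inner_complex_def)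
  have 3: "2 * Re (g * n) = b" using u'_n unfolding blinfun_apply_wirtinger_gradient by (simp add: g_def)
  \<comment> \<open>Both factors are imaginary, so \<open>g n\<close> is real and \<open>|g| |n| = |b| / 2\<close>.\<close>
  have "Im ((g * \<tau>) * (n * cnj \<tau>)) = 0" unfolding times_complex.sel(2)[of "g * \<tau>"] 1 2 by simp
  moreover have "(g * \<tau>) * (n * cnj \<tau>) = complex_of_real ((norm \<tau>)\<^sup>2) * (g * n)"
    unfolding complex_norm_square by (simp add: mult_ac)
  ultimately have "Im (g * n) = 0" using \<tau> by (simp del: of_real_power)
  then have "(norm (g * n))\<^sup>2 = (Re (g * n))\<^sup>2" by (simp add: cmod_power2)
  moreover have "b\<^sup>2 = 4 * (Re (g * n))\<^sup>2"
    unfolding 3[symmetric] power_mult_distrib by simp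
  moreover have "(norm (g * n))\<^sup>2 = (norm g)\<^sup>2 * (norm n)\<^sup>2"
    by (simp add: norm_mult power_mult_distrib)
  ultimately have "4 * ((norm g)\<^sup>2 * (norm n)\<^sup>2) = b\<^sup>2" by (simp only:)
  then show ?thesis unfolding g_def[symmetric] n_norm[symmetric] by (simp add: mult_ac)
qed

section \<open>The symmetry theorem\<close>

lemma overdetermined_disk_of_positive:
  fixes u :: "complex \<Rightarrow> real" and u' :: "complex \<Rightarrow> complex \<Rightarrow>\<^sub>L real"
    and u'' :: "complex \<Rightarrow> complex \<Rightarrow>\<^sub>L complex \<Rightarrow>\<^sub>L real"
  assumes S: "open S" "connected S" "S \<noteq> {}" "closure S \<subseteq> ball 0 1"
    and bd: "C2_holder_boundary \<alpha> S"
    and \<nu>: "\<And>z. z \<in> frontier S \<Longrightarrow> exterior_unit_normal S z (\<nu> z)"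
    and u': "\<And>z. z \<in> S \<Longrightarrow> (u has_derivative blinfun_apply (u' z)) (at z)"
    and u'': "\<And>z. z \<in> S \<Longrightarrow> (u' has_derivative blinfun_apply (u'' z)) (at z)"
    and cont: "continuous_on (closure S) u" "continuous_on (closure S) u'" "continuous_on S u''"
    and eq: "\<And>z. z \<in> S \<Longrightarrow> hyp_laplacian u z = 2 * u z"
    and ua: "\<And>z. z \<in> frontier S \<Longrightarrow> u z = a"
    and ub: "\<And>z. z \<in> frontier S \<Longrightarrow> has_exterior_derivative u (\<nu> z) z b"
    and a: "a > 0" and ab: "a\<^sup>2 \<noteq> b\<^sup>2"
  shows "\<exists>c R B. c \<in> ball 0 1 \<and> R > 0 \<and> S = hyp_disk c R \<and>
    (\<forall>z\<in>closure S. u z = B * cosh (hyp_dist c z)) \<and> a\<^sup>2 - b\<^sup>2 = B\<^sup>2 \<and> B\<^sup>2 > 0"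
proof -
  have disk: "S \<subseteq> ball 0 1" using S(4) closure_subset by blast
  interpret hyperbolic_solution S u "\<lambda>z. wirtinger_gradient (u' z)"
    "\<lambda>z. (complex_of_real (u'' z 1 1) - complex_of_real (u'' z \<i> \<i>)
       - 2 * \<i> * complex_of_real (u'' z 1 \<i>)) / 4"
    by (rule hyperbolic_solution_of_C2[OF S(1) disk u' u'' cont(3) eq])
  interpret hyperbolic_dirichlet S u "\<lambda>z. wirtinger_gradient (u' z)"
    "\<lambda>z. (complex_of_real (u'' z 1 1) - complex_of_real (u'' z \<i> \<i>)
       - 2 * \<i> * complex_of_real (u'' z 1 \<i>)) / 4" a
    by unfold_locales (use S cont a ua in auto)
  have grad: "(1 - (norm z)\<^sup>2)\<^sup>2 * (norm (wirtinger_gradient (u' z)))\<^sup>2 = b\<^sup>2" if z: "z \<in> frontier S" for z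
  proof (rule overdetermined_gradient_norm[OF S(1) bd z _ \<nu>[OF z] cont(1,2) u' _ ub[OF z]])
    show "norm z < 1" using z S(4) by (auto simp: frontier_def)
    show "u w \<le> u z" if "w \<in> S" for w using u_less[OF a that] ua[OF z] by simp
  qed
  interpret hyperbolic_overdetermined S u "\<lambda>z. wirtinger_gradient (u' z)"
    "\<lambda>z. (complex_of_real (u'' z 1 1) - complex_of_real (u'' z \<i> \<i>)
       - 2 * \<i> * complex_of_real (u'' z 1 \<i>)) / 4" a b
    by unfold_locales (use a continuous_on_wirtinger_gradient[OF cont(2)] grad in auto)
  show ?thesis by (rule solution_is_radial[OF S(2) ab])
qed

lemma hyp_laplacian_minus:
  fixes u :: "complex \<Rightarrow> real" and u' :: "complex \<Rightarrow> complex \<Rightarrow>\<^sub>L real"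
  assumes S: "open S" "z \<in> S" "S \<subseteq> ball 0 1"
    and u': "\<And>z. z \<in> S \<Longrightarrow> (u has_derivative blinfun_apply (u' z)) (at z)"
    and u'': "(u' has_derivative blinfun_apply D) (at z)"
  shows "hyp_laplacian (\<lambda>z. - u z) z = - hyp_laplacian u z"
proof -
  have "dir_deriv (dir_deriv (\<lambda>z. - u z) e) e z = - dir_deriv (dir_deriv u e) e z" for e
  proof -
    have "dir_deriv (dir_deriv (\<lambda>z. - u z) e) e z = blinfun_apply (- D) e e"
      by (rule dir_deriv_dir_deriv[OF S(1,2)])
         (auto intro: has_derivative_minus_blinfun u' u'')
    also have "\<dots> = - dir_deriv (dir_deriv u e) e z"
      by (simp add: dir_deriv_dir_deriv[OF S(1,2) u' u''] blinfun.minus_left)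
    finally show ?thesis .
  qed
  moreover have "z \<in> ball 0 1" using S by blast
  ultimately show ?thesis by (simp add: hyp_laplacian_conformal algebra_simps)
qed

theorem theoremB:
  fixes \<Omega> :: "complex set" and u :: "complex \<Rightarrow> real" and \<nu> :: "complex \<Rightarrow> complex"
    and \<alpha> a b :: real
  assumes "\<Omega> \<subseteq> ball 0 1" and "open \<Omega>" and "connected \<Omega>"
    and "hyp_bounded \<Omega>" and "simply_connected \<Omega>"
    and "0 < \<alpha>" and "\<alpha> < 1" and "C2_holder_boundary \<alpha> \<Omega>"
    and "\<And>z. z \<in> frontier \<Omega> \<Longrightarrow> exterior_unit_normal \<Omega> z (\<nu> z)"
    and "C2_on \<Omega> u" and "C1_closure \<Omega> u" and "\<exists>z\<in>\<Omega>. u z \<noteq> 0"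
    and "\<And>z. z \<in> \<Omega> \<Longrightarrow> hyp_laplacian u z - 2 * u z = 0"
    and "\<And>z. z \<in> frontier \<Omega> \<Longrightarrow> u z = a"
    and "\<And>z. z \<in> frontier \<Omega> \<Longrightarrow> has_exterior_derivative u (\<nu> z) z b"
    and "a\<^sup>2 \<noteq> b\<^sup>2"
  shows "\<exists>c R A. c \<in> ball 0 1 \<and> R > 0 \<and> \<Omega> = hyp_disk c R \<and>
    (\<forall>z\<in>closure \<Omega>. u z = A * cosh (hyp_dist c z)) \<and> a\<^sup>2 - b\<^sup>2 = A\<^sup>2 \<and> A\<^sup>2 > 0"
proof -
  have ne: "\<Omega> \<noteq> {}" using assms(12) by blast
  have cl: "closure \<Omega> \<subseteq> ball 0 1" by (rule hyp_bounded_closure[OF assms(1,4)])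
  obtain u2' :: "complex \<Rightarrow> complex \<Rightarrow>\<^sub>L real" and u'' :: "complex \<Rightarrow> complex \<Rightarrow>\<^sub>L complex \<Rightarrow>\<^sub>L real"
    where u2': "\<And>z. z \<in> \<Omega> \<Longrightarrow> (u has_derivative blinfun_apply (u2' z)) (at z)"
      "\<And>z. z \<in> \<Omega> \<Longrightarrow> (u2' has_derivative blinfun_apply (u'' z)) (at z)"
    and cu'': "continuous_on \<Omega> u''"
    using assms(10) unfolding C2_on_def by blast
  obtain u' :: "complex \<Rightarrow> complex \<Rightarrow>\<^sub>L real" where cu': "continuous_on (closure \<Omega>) u'"
    and u': "\<And>z. z \<in> \<Omega> \<Longrightarrow> (u has_derivative blinfun_apply (u' z)) (at z)"
    using assms(11) unfolding C1_closure_def by blast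
  have cu: "continuous_on (closure \<Omega>) u" using assms(11) unfolding C1_closure_def by blast
  \<comment> \<open>The differentials from the two regularity assumptions agree in the domain, so one function \<open>u'\<close>
    is both differentiable there and continuous on the closure.\<close>
  have "u2' z = u' z" if "z \<in> \<Omega>" for z
    using has_derivative_unique[OF u2'(1)[OF that] u'[OF that]] by (simp add: blinfun_eqI)
  then have u'': "(u' has_derivative blinfun_apply (u'' z)) (at z)" if "z \<in> \<Omega>" for z
    using has_derivative_transform_within_open[OF u2'(2)[OF that] assms(2) that] by blast
  have eq: "hyp_laplacian u z = 2 * u z" if "z \<in> \<Omega>" for z using assms(13)[OF that] by simp
  have m': "((\<lambda>z. - u z) has_derivative blinfun_apply (- u' z)) (at z)" if "z \<in> \<Omega>" for z
    by (rule has_derivative_minus_blinfun[OF u'[OF that]])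
  have m'': "((\<lambda>z. - u' z) has_derivative blinfun_apply (- u'' z)) (at z)" if "z \<in> \<Omega>" for z
    by (rule has_derivative_minus_blinfun[OF u''[OF that]])
  have meq: "hyp_laplacian (\<lambda>z. - u z) z = 2 * - u z" if "z \<in> \<Omega>" for z
    using hyp_laplacian_minus[OF assms(2) that assms(1) u' u''[OF that]] eq[OF that] by simp
  have mc: "continuous_on (closure \<Omega>) (\<lambda>z. - u z)" "continuous_on (closure \<Omega>) (\<lambda>z. - u' z)"
    "continuous_on \<Omega> (\<lambda>z. - u'' z)"
    by (intro continuous_intros cu cu' cu'')+
  consider "a > 0" | "a < 0" | "a = 0" by linarith
  then show ?thesis
  proof cases
    case 1
    show ?thesis
      by (rule overdetermined_disk_of_positive[OF assms(2,3) ne cl assms(8) assms(9) u' u''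
            cu cu' cu'' eq assms(14,15) 1 assms(16)])
  next
    case 2
    have mb: "has_exterior_derivative (\<lambda>z. - u z) (\<nu> z) z (- b)" if "z \<in> frontier \<Omega>" for z
      using tendsto_minus[OF assms(15)[OF that, unfolded has_exterior_derivative_def]]
      by (simp add: has_exterior_derivative_def minus_divide_left)
    have "\<exists>c R B. c \<in> ball 0 1 \<and> R > 0 \<and> \<Omega> = hyp_disk c R \<and>
      (\<forall>z\<in>closure \<Omega>. - u z = B * cosh (hyp_dist c z)) \<and> (- a)\<^sup>2 - (- b)\<^sup>2 = B\<^sup>2 \<and> B\<^sup>2 > 0"
      by (rule overdetermined_disk_of_positive[OF assms(2,3) ne cl assms(8) assms(9) m' m'' mc meq _ mb])
         (use 2 assms(14,16) in auto)
    then obtain c R B where cRB: "c \<in> ball 0 1" "R > 0" "\<Omega> = hyp_disk c R"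
      "\<And>z. z \<in> closure \<Omega> \<Longrightarrow> - u z = B * cosh (hyp_dist c z)" "(- a)\<^sup>2 - (- b)\<^sup>2 = B\<^sup>2" "B\<^sup>2 > 0"
      by blast
    have "u z = - B * cosh (hyp_dist c z)" if "z \<in> closure \<Omega>" for z
      using cRB(4)[OF that] by simp
    then show ?thesis using cRB by (intro exI[of _ c] exI[of _ R] exI[of _ "- B"]) simp
  next
    case 3
    have nonneg: "0 \<le> v z" if z: "z \<in> \<Omega>" and sol: "hyperbolic_solution \<Omega> v g A"
      and v: "continuous_on (closure \<Omega>) v" "\<And>z. z \<in> frontier \<Omega> \<Longrightarrow> v z = 0" for v g A z
    proof -
      interpret hyperbolic_solution \<Omega> v g A by fact
      interpret hyperbolic_dirichlet \<Omega> v g A 0 by unfold_locales (use cl ne v in auto)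
      show ?thesis by (rule u_nonneg[OF z])
    qed
    have "u z = 0" if z: "z \<in> \<Omega>" for z
      using nonneg[OF z hyperbolic_solution_of_C2[OF assms(2,1) u' u'' cu'' eq] cu]
        nonneg[OF z hyperbolic_solution_of_C2[OF assms(2,1) m' m'' mc(3) meq] mc(1)] assms(14) 3
      by fastforce
    then show ?thesis using assms(12) by blast
  qed
qed

end
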